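(* Let $\mathcal{A}$ be a unital $C^*$-algebra, let $U$ and $V$ be Hilbert $\mathcal{A}$-modules, let $(\Omega,\mu)$ be a measure space, and let $\{V_w\}_{w\in\Omega}$ be a family of closed submodules of $V$. Let $K\in End_{\mathcal{A}}^{*}(U)$ be surjective, and let $\{\Lambda_w\in End_{\mathcal{A}}^{*}(U,V_w): w\in\Omega\}$ be a continuous $*$-K-g-frame for $U$ with respect to $\{V_w\}_{w\in\Omega}$, with lower and upper bounds $A$ and $B$ respectively, and with continuous $*$-K-g-frame operator $S$, $Sx=\int_\Omega\Lambda_w^*\Lambda_w x\,d\mu(w)$. Let $T\in End_{\mathcal{A}}^{*}(U)$ be invertible. Then $\{\Lambda_w T: w\in\Omega\}$ is a continuous $*$-K-g-frame for $U$ with respect to $\{V_w\}_{w\in\Omega}$, and its continuous $*$-K-g-frame operator is $T^*ST$.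
   Context: Hilbert $\mathcal{A}$-modules are left modules over the unital $C^*$-algebra $\mathcal{A}$ with $\mathcal{A}$-valued inner product $\langle\cdot,\cdot\rangle$, $\mathcal{A}$-linear in the first variable, and norm $\|x\|=\|\langle x,x\rangle\|^{1/2}$. $End_{\mathcal{A}}^{*}(U,W)$ is the set of adjointable operators from $U$ to $W$, and $End_{\mathcal{A}}^{*}(U)=End_{\mathcal{A}}^{*}(U,U)$. Inequalities between elements of $\mathcal{A}$ are in the usual order on selfadjoint elements. Continuous $*$-K-g-frame: given $K\in End_{\mathcal{A}}^{*}(U)$, a family $\{\Lambda_w\in End_{\mathcal{A}}^{*}(U,V_w): w\in\Omega\}$ is a continuous $*$-K-g-frame for $U$ with respect to $\{V_w\}_{w\in\Omega}$ if (1) for every $x\in U$ the function $w\mapsto \Lambda_w x$ (viewed as $V$-valued) is measurable, and (2) there are strictly nonzero elements $A,B\in\mathcal{A}$ (strictly nonzero means $0$ is not in the spectrum, i.e. the element is invertible) such that $$A\langle K^*x,K^*x\rangle A^*\le\int_\Omega\langle\Lambda_w x,\Lambda_w x\rangle\,d\mu(w)\le B\langle x,x\rangle B^*\quad\text{for all }x\in U.$$ $A$ and $B$ are called the lower and upper bounds. The continuous $*$-K-g-frame operator of such a family is the map $S:U\to U$, $Sx=\int_\Omega\Lambda_w^*\Lambda_w x\,d\mu(w)$. Integrals of functions with values in $\mathcal{A}$ or in a Hilbert module are Bochner integrals; in particular, for the given family $\{\Lambda_w\}$, the integrals in the definition of the frame and of the operator $S$ are assumed to exist for every $x\in U$. 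*)

theory Defs
  imports "HOL-Analysis.Analysis"
begin

section \<open>Complex Banach spaces and unital C*-algebras\<close>

class complex_vector = real_vector +
  fixes scaleC :: "complex \<Rightarrow> 'a \<Rightarrow> 'a" (infixr "*\<^sub>C" 75)
  assumes scaleC_add_right: "c *\<^sub>C (x + y) = c *\<^sub>C x + c *\<^sub>C y"
    and scaleC_add_left: "(c + d) *\<^sub>C x = c *\<^sub>C x + d *\<^sub>C x"
    and scaleC_scaleC: "c *\<^sub>C (d *\<^sub>C x) = (c * d) *\<^sub>C x"
    and scaleR_scaleC: "r *\<^sub>R x = complex_of_real r *\<^sub>C x"

class complex_normed_vector = complex_vector + real_normed_vector +
  assumes norm_scaleC: "norm (c *\<^sub>C x) = cmod c * norm x"

class complex_banach = complex_normed_vector + complete_space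

class cstar_algebra = complex_banach + real_normed_algebra +
  fixes star :: "'a \<Rightarrow> 'a"
  assumes mult_scaleC_left: "(c *\<^sub>C a) * b = c *\<^sub>C (a * b)"
    and mult_scaleC_right: "a * (c *\<^sub>C b) = c *\<^sub>C (a * b)"
    and star_star: "star (star a) = a"
    and star_add: "star (a + b) = star a + star b"
    and star_scaleC: "star (c *\<^sub>C a) = cnj c *\<^sub>C star a"
    and star_mult: "star (a * b) = star b * star a"
    and cstar_identity: "norm (star a * a) = (norm a)\<^sup>2"

text \<open>The unit comes from \<^class>\<open>monoid_mult\<close> rather than \<^class>\<open>ring_1\<close>, so that the zero
  algebra is not excluded.\<close>

class unital_cstar_algebra = cstar_algebra + monoid_mult

definition invertible_elem :: "'a::unital_cstar_algebra \<Rightarrow> bool" where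
  "invertible_elem a \<longleftrightarrow> (\<exists>b. a * b = 1 \<and> b * a = 1)"

definition spectrum :: "'a::unital_cstar_algebra \<Rightarrow> complex set" where
  "spectrum a = {c. \<not> invertible_elem (a - c *\<^sub>C 1)}"

definition strictly_nonzero :: "'a::unital_cstar_algebra \<Rightarrow> bool" where
  "strictly_nonzero a \<longleftrightarrow> 0 \<notin> spectrum a"

lemma strictly_nonzero_iff_invertible: "strictly_nonzero a \<longleftrightarrow> invertible_elem a"
proof -
  have "(0::complex) *\<^sub>C x = 0" for x :: 'a
    using scaleR_scaleC[of 0 x] by simp
  then show ?thesis by (simp add: strictly_nonzero_def spectrum_def)
qed

definition selfadjoint :: "'a::cstar_algebra \<Rightarrow> bool" where
  "selfadjoint a \<longleftrightarrow> star a = a"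

definition positive_elem :: "'a::unital_cstar_algebra \<Rightarrow> bool" where
  "positive_elem a \<longleftrightarrow> selfadjoint a \<and> spectrum a \<subseteq> complex_of_real ` {0..}"

definition cstar_le :: "'a::unital_cstar_algebra \<Rightarrow> 'a \<Rightarrow> bool" (infix "\<preceq>" 50) where
  "a \<preceq> b \<longleftrightarrow> selfadjoint a \<and> selfadjoint b \<and> positive_elem (b - a)"


section \<open>Hilbert modules and adjointable operators\<close>

text \<open>Completeness of the module is part of the sort of \<^typ>\<open>'u\<close>.\<close>

locale hilbert_module =
  fixes act :: "'a::unital_cstar_algebra \<Rightarrow> 'u::complex_banach \<Rightarrow> 'u"
    and ip :: "'u \<Rightarrow> 'u \<Rightarrow> 'a"
  assumes act_add_right: "act a (x + y) = act a x + act a y"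
    and act_add_left: "act (a + b) x = act a x + act b x"
    and act_smult: "act a (act b x) = act (a * b) x"
    and act_one: "act 1 x = x"
    and act_scaleC_left: "act (c *\<^sub>C a) x = c *\<^sub>C act a x"
    and act_scaleC_right: "act a (c *\<^sub>C x) = c *\<^sub>C act a x"
    and ip_add_left: "ip (x + y) z = ip x z + ip y z"
    and ip_act_left: "ip (act a x) y = a * ip x y"
    and ip_commute: "ip x y = star (ip y x)"
    and ip_positive: "positive_elem (ip x x)"
    and ip_eq_zero_iff: "ip x x = 0 \<longleftrightarrow> x = 0"
    and norm_eq_sqrt_ip: "norm x = sqrt (norm (ip x x))"

definition closed_submodule ::
    "('a::unital_cstar_algebra \<Rightarrow> 'v::complex_banach \<Rightarrow> 'v) \<Rightarrow> 'v set \<Rightarrow> bool" where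
  "closed_submodule act W \<longleftrightarrow>
     closed W \<and> 0 \<in> W \<and> (\<forall>x\<in>W. \<forall>y\<in>W. x + y \<in> W) \<and> (\<forall>a. \<forall>x\<in>W. act a x \<in> W)"

text \<open>\<open>End_star ipU ipV W\<close> is the set of adjointable operators from the module \<open>U\<close> (the whole
  type \<^typ>\<open>'u\<close>) to the submodule \<open>W\<close> of \<open>V\<close>. Adjoints are only tested against vectors of \<open>W\<close>:
  an adjoint is a map from \<open>W\<close> to \<open>U\<close>. Linearity and boundedness are consequences.\<close>

definition End_star ::
    "('u \<Rightarrow> 'u \<Rightarrow> 'a) \<Rightarrow> ('v \<Rightarrow> 'v \<Rightarrow> 'a) \<Rightarrow> 'v set \<Rightarrow> ('u \<Rightarrow> 'v) set" where
  "End_star ipU ipV W =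
     {L. (\<forall>x. L x \<in> W) \<and> (\<exists>L'. \<forall>x. \<forall>y\<in>W. ipV (L x) y = ipU x (L' y))}"

text \<open>The value of the adjoint at \<open>y\<close>; it is determined for every \<open>y \<in> W\<close> if
  \<open>L \<in> End_star ipU ipV W\<close>, and does not depend on \<open>W\<close>.\<close>

definition adjoint_op ::
    "('u \<Rightarrow> 'u \<Rightarrow> 'a) \<Rightarrow> ('v \<Rightarrow> 'v \<Rightarrow> 'a) \<Rightarrow> ('u \<Rightarrow> 'v) \<Rightarrow> 'v \<Rightarrow> 'u" where
  "adjoint_op ipU ipV L y = (THE z. \<forall>x. ipV (L x) y = ipU x z)"

lemma (in hilbert_module) ip_eqI:
  assumes "\<And>x. ip x y = ip x z" shows "y = z"
proof -
  have "ip y (y - z) = ip z (y - z)"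
    by (subst (1 2) ip_commute) (simp add: assms)
  moreover have "ip (y - z) (y - z) + ip z (y - z) = ip y (y - z)"
    using ip_add_left[of "y - z" z "y - z"] by simp
  ultimately have "ip (y - z) (y - z) = 0" by simp
  then show ?thesis using ip_eq_zero_iff by simp
qed

lemma adjoint_op_eq:
  assumes "hilbert_module act ipU" and "L \<in> End_star ipU ipV W" and "y \<in> W"
  shows "ipV (L x) y = ipU x (adjoint_op ipU ipV L y)"
proof -
  interpret hilbert_module act ipU by fact
  obtain L' where L': "\<forall>x. \<forall>y\<in>W. ipV (L x) y = ipU x (L' y)"
    using assms(2) by (auto simp: End_star_def)
  have "\<forall>x. ipV (L x) y = ipU x (adjoint_op ipU ipV L y)"
    unfolding adjoint_op_def
    by (rule theI[of _ "L' y"]) (use L' assms(3) in \<open>auto intro: ip_eqI\<close>)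
  then show ?thesis by simp
qed

definition invertible_in_End_star :: "('u \<Rightarrow> 'u \<Rightarrow> 'a) \<Rightarrow> ('u \<Rightarrow> 'u) \<Rightarrow> bool" where
  "invertible_in_End_star ipU T \<longleftrightarrow>
     (\<exists>R\<in>End_star ipU ipU UNIV. T \<circ> R = id \<and> R \<circ> T = id)"


section \<open>The Bochner integral without separability\<close>

text \<open>The library's \<^const>\<open>has_bochner_integral\<close> is confined to second countable spaces, whereas
  C*-algebras and Hilbert modules need not be separable. The definition below is the library's one
  with Borel measurability replaced by strong measurability; the two agree on second countable
  spaces, see \<open>has_strong_bochner_integral_iff\<close>.\<close>

definition strongly_measurable :: "'w measure \<Rightarrow> ('w \<Rightarrow> 'b::real_normed_vector) \<Rightarrow> bool" where
  "strongly_measurable M f \<longleftrightarrow>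
     (\<exists>s. (\<forall>i. simple_function M (s i)) \<and> (\<forall>w\<in>space M. (\<lambda>i. s i w) \<longlonglongrightarrow> f w))"

definition has_strong_bochner_integral ::
    "'w measure \<Rightarrow> ('w \<Rightarrow> 'b::real_normed_vector) \<Rightarrow> 'b \<Rightarrow> bool" where
  "has_strong_bochner_integral M f I \<longleftrightarrow>
     strongly_measurable M f \<and>
     (\<exists>s. (\<forall>i. Bochner_Integration.simple_bochner_integrable M (s i)) \<and>
          (\<lambda>i. \<integral>\<^sup>+w. ennreal (norm (f w - s i w)) \<partial>M) \<longlonglongrightarrow> 0 \<and>
          (\<lambda>i. Bochner_Integration.simple_bochner_integral M (s i)) \<longlonglongrightarrow> I)"

definition strong_bochner_integrable ::
    "'w measure \<Rightarrow> ('w \<Rightarrow> 'b::real_normed_vector) \<Rightarrow> bool" where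
  "strong_bochner_integrable M f \<longleftrightarrow> (\<exists>I. has_strong_bochner_integral M f I)"

definition strong_bochner_integral ::
    "'w measure \<Rightarrow> ('w \<Rightarrow> 'b::real_normed_vector) \<Rightarrow> 'b" where
  "strong_bochner_integral M f = (THE I. has_strong_bochner_integral M f I)"

lemma strongly_measurable_norm_diff:
  assumes "strongly_measurable M f" and "simple_function M t"
  shows "(\<lambda>w. norm (f w - t w)) \<in> borel_measurable M"
proof -
  obtain s where s: "\<And>i. simple_function M (s i)" "\<And>w. w \<in> space M \<Longrightarrow> (\<lambda>i. s i w) \<longlonglongrightarrow> f w"
    using assms(1) by (auto simp: strongly_measurable_def)
  show ?thesis
  proof (rule borel_measurable_LIMSEQ_real)
    show "(\<lambda>i. norm (s i w - t w)) \<longlonglongrightarrow> norm (f w - t w)" if "w \<in> space M" for w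
      using s(2)[OF that] by (intro tendsto_intros)
    show "(\<lambda>w. norm (s i w - t w)) \<in> borel_measurable M" for i
      by (intro borel_measurable_simple_function simple_function_compose2[where h="\<lambda>a b. norm (a - b)"]
          s assms(2))
  qed
qed

lemma has_strong_bochner_integral_unique:
  assumes "has_strong_bochner_integral M f I" and "has_strong_bochner_integral M f J"
  shows "I = J"
proof -
  have f: "strongly_measurable M f" using assms(1) by (simp add: has_strong_bochner_integral_def)
  obtain s where s: "\<And>i. Bochner_Integration.simple_bochner_integrable M (s i)"
      "(\<lambda>i. \<integral>\<^sup>+w. ennreal (norm (f w - s i w)) \<partial>M) \<longlonglongrightarrow> 0"
      "(\<lambda>i. Bochner_Integration.simple_bochner_integral M (s i)) \<longlonglongrightarrow> I"
    using assms(1) by (auto simp: has_strong_bochner_integral_def)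
  obtain t where t: "\<And>i. Bochner_Integration.simple_bochner_integrable M (t i)"
      "(\<lambda>i. \<integral>\<^sup>+w. ennreal (norm (f w - t i w)) \<partial>M) \<longlonglongrightarrow> 0"
      "(\<lambda>i. Bochner_Integration.simple_bochner_integral M (t i)) \<longlonglongrightarrow> J"
    using assms(2) by (auto simp: has_strong_bochner_integral_def)
  have sf: "simple_function M (s i)" "simple_function M (t i)" for i
    using s(1) t(1) by (auto elim: simple_bochner_integrable.cases)
  let ?d = "\<lambda>i. norm (Bochner_Integration.simple_bochner_integral M (s i) - Bochner_Integration.simple_bochner_integral M (t i))"
  let ?e = "\<lambda>i. (\<integral>\<^sup>+w. ennreal (norm (f w - s i w)) \<partial>M) + (\<integral>\<^sup>+w. ennreal (norm (f w - t i w)) \<partial>M)"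
  have le: "ennreal (?d i) \<le> ?e i" for i
  proof -
    have "?d i = norm (Bochner_Integration.simple_bochner_integral M (\<lambda>w. s i w - t i w))"
      using s(1) t(1) by (subst simple_bochner_integral_diff) auto
    also have "\<dots> \<le> Bochner_Integration.simple_bochner_integral M (\<lambda>w. norm (s i w - t i w))"
      using simple_bochner_integrable_compose2[of "(-)" M "s i" "t i"] s(1) t(1)
      by (auto intro!: simple_bochner_integral_norm_bound)
    finally have "ennreal (?d i) \<le> ennreal (Bochner_Integration.simple_bochner_integral M (\<lambda>w. norm (s i w - t i w)))"
      by (rule ennreal_leI)
    also have "\<dots> = (\<integral>\<^sup>+w. ennreal (norm (s i w - t i w)) \<partial>M)"
      using simple_bochner_integrable_compose2[of "\<lambda>x y. norm (x - y)" M "s i" "t i"] s(1) t(1)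
      by (auto intro!: simple_bochner_integral_eq_nn_integral)
    also have "\<dots> \<le> (\<integral>\<^sup>+w. ennreal (norm (f w - s i w)) + ennreal (norm (f w - t i w)) \<partial>M)"
    proof (rule nn_integral_mono)
      fix w
      have "norm (s i w - t i w) \<le> norm (f w - s i w) + norm (f w - t i w)"
        by (metis dual_order.refl norm_diff_triangle_le norm_minus_commute)
      then show "ennreal (norm (s i w - t i w))
          \<le> ennreal (norm (f w - s i w)) + ennreal (norm (f w - t i w))"
        by (metis ennreal_leI ennreal_plus norm_ge_zero)
    qed
    also have "\<dots> = ?e i"
      by (intro nn_integral_add measurable_compose[OF strongly_measurable_norm_diff[OF f] measurable_ennreal] sf)
    finally show ?thesis .
  qed
  have "(\<lambda>i. ennreal (?d i)) \<longlonglongrightarrow> ennreal 0"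
  proof (rule tendsto_sandwich[of "\<lambda>_. 0" _ _ ?e])
    show "?e \<longlonglongrightarrow> ennreal 0" using tendsto_add[OF s(2) t(2)] by simp
  qed (use le in auto)
  then have "?d \<longlonglongrightarrow> 0" by (subst (asm) tendsto_ennreal_iff) auto
  moreover have "?d \<longlonglongrightarrow> norm (I - J)" using s(3) t(3) by (intro tendsto_intros)
  ultimately have "norm (I - J) = 0" using LIMSEQ_unique by blast
  then show ?thesis by simp
qed

lemma has_strong_bochner_integral_eq:
  "has_strong_bochner_integral M f I \<Longrightarrow> strong_bochner_integral M f = I"
  unfolding strong_bochner_integral_def
  by (rule the_equality) (auto intro: has_strong_bochner_integral_unique)

lemma has_strong_bochner_integral_iff:
  fixes f :: "'w \<Rightarrow> 'b::{real_normed_vector, second_countable_topology}"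
  shows "has_strong_bochner_integral M f I \<longleftrightarrow> has_bochner_integral M f I"
proof -
  have "strongly_measurable M f \<longleftrightarrow> f \<in> borel_measurable M"
  proof
    assume "strongly_measurable M f"
    then obtain s where "\<And>i. simple_function M (s i)" "\<And>w. w \<in> space M \<Longrightarrow> (\<lambda>i. s i w) \<longlonglongrightarrow> f w"
      by (auto simp: strongly_measurable_def)
    then show "f \<in> borel_measurable M"
      using borel_measurable_LIMSEQ_metric[of s M f] borel_measurable_simple_function[of M "s _"]
      by blast
  next
    assume "f \<in> borel_measurable M"
    from borel_measurable_implies_sequence_metric[OF this, of 0] show "strongly_measurable M f"
      unfolding strongly_measurable_def by blast
  qed
  then show ?thesis
    unfolding has_strong_bochner_integral_def has_bochner_integral.simps by blast
qed


section \<open>Continuous *-K-g-frames\<close>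

definition continuous_star_K_g_frame_bounds ::
    "'w measure \<Rightarrow> ('u \<Rightarrow> 'u \<Rightarrow> 'a::unital_cstar_algebra) \<Rightarrow> ('v::complex_banach \<Rightarrow> 'v \<Rightarrow> 'a) \<Rightarrow>
     ('w \<Rightarrow> 'v set) \<Rightarrow> ('u::complex_banach \<Rightarrow> 'u) \<Rightarrow> ('w \<Rightarrow> 'u \<Rightarrow> 'v) \<Rightarrow> 'a \<Rightarrow> 'a \<Rightarrow> bool" where
  "continuous_star_K_g_frame_bounds M ipU ipV Vw K \<Lambda> A B \<longleftrightarrow>
     (\<forall>w\<in>space M. \<Lambda> w \<in> End_star ipU ipV (Vw w)) \<and>
     (\<forall>x. (\<lambda>w. \<Lambda> w x) \<in> borel_measurable M) \<and>
     strictly_nonzero A \<and> strictly_nonzero B \<and>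
     (\<forall>x. strong_bochner_integrable M (\<lambda>w. ipV (\<Lambda> w x) (\<Lambda> w x)) \<and>
          A * ipU (adjoint_op ipU ipU K x) (adjoint_op ipU ipU K x) * star A
            \<preceq> strong_bochner_integral M (\<lambda>w. ipV (\<Lambda> w x) (\<Lambda> w x)) \<and>
          strong_bochner_integral M (\<lambda>w. ipV (\<Lambda> w x) (\<Lambda> w x)) \<preceq> B * ipU x x * star B)"

definition continuous_star_K_g_frame ::
    "'w measure \<Rightarrow> ('u \<Rightarrow> 'u \<Rightarrow> 'a::unital_cstar_algebra) \<Rightarrow> ('v::complex_banach \<Rightarrow> 'v \<Rightarrow> 'a) \<Rightarrow>
     ('w \<Rightarrow> 'v set) \<Rightarrow> ('u::complex_banach \<Rightarrow> 'u) \<Rightarrow> ('w \<Rightarrow> 'u \<Rightarrow> 'v) \<Rightarrow> bool" where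
  "continuous_star_K_g_frame M ipU ipV Vw K \<Lambda> \<longleftrightarrow>
     (\<exists>A B. continuous_star_K_g_frame_bounds M ipU ipV Vw K \<Lambda> A B)"

text \<open>Integrability in the definition of the frame operator is kept as a separate predicate:
  where the integral does not exist, \<open>frame_operator\<close> has an unspecified value.\<close>

definition frame_operator_exists ::
    "'w measure \<Rightarrow> ('u \<Rightarrow> 'u \<Rightarrow> 'a) \<Rightarrow> ('v \<Rightarrow> 'v \<Rightarrow> 'a) \<Rightarrow> ('w \<Rightarrow> 'u::complex_banach \<Rightarrow> 'v) \<Rightarrow> bool" where
  "frame_operator_exists M ipU ipV \<Lambda> \<longleftrightarrow>
     (\<forall>x. strong_bochner_integrable M (\<lambda>w. adjoint_op ipU ipV (\<Lambda> w) (\<Lambda> w x)))"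

definition frame_operator ::
    "'w measure \<Rightarrow> ('u \<Rightarrow> 'u \<Rightarrow> 'a) \<Rightarrow> ('v \<Rightarrow> 'v \<Rightarrow> 'a) \<Rightarrow> ('w \<Rightarrow> 'u::complex_banach \<Rightarrow> 'v) \<Rightarrow> 'u \<Rightarrow> 'u" where
  "frame_operator M ipU ipV \<Lambda> x =
     strong_bochner_integral M (\<lambda>w. adjoint_op ipU ipV (\<Lambda> w) (\<Lambda> w x))"

end

theory Submission
  imports Defs
begin

text \<open>
  Write \<open>\<langle>x,y\<rangle>\<close> for the inner product and \<open>K'\<close>, \<open>T'\<close> for the adjoints. Applying the frame inequality to
  \<open>T x\<close> gives
  \<open>A \<langle>K' T x, K' T x\<rangle> A* \<le> \<integral> \<langle>\<Lambda> T x, \<Lambda> T x\<rangle> \<le> B \<langle>T x, T x\<rangle> B*\<close>.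
  It remains to compare the outer terms with multiples of \<open>A \<langle>K' x, K' x\<rangle> A*\<close> and \<open>B \<langle>x, x\<rangle> B*\<close>; the new
  bounds are then positive real multiples of \<open>A\<close> and \<open>B\<close>.

  The comparison rests on the domination principle \<open>ip_self_le_of_norm_le\<close>: if \<open>F\<close> and \<open>G\<close> commute with the
  action of the algebra and \<open>norm (F x) \<le> q * norm (G x)\<close> for all \<open>x\<close>, with \<open>0 \<le> q < 1\<close>, then
  \<open>\<langle>F x, F x\<rangle> \<le> \<langle>G x, G x\<rangle>\<close>. As \<open>A \<langle>F x, F x\<rangle> A* = \<langle>F (A x), F (A x)\<rangle>\<close>, such inequalities can be multiplied
  by \<open>A\<close> and \<open>A*\<close> simply by evaluating them at \<open>A x\<close>. Only inequalities between norms are left: \<open>T\<close>, its inverse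
  and \<open>K'\<close> are bounded (\<open>adjointable_bounded\<close>), and \<open>K'\<close> is bounded below because \<open>K\<close> is surjective
  (\<open>adjoint_of_surjective_bounded_below\<close>). Both facts follow from uniform boundedness, that is, from
  Baire's theorem. Hence \<open>norm (K' x)\<close> is at most a multiple of \<open>norm (K' (T x))\<close>, and \<open>norm (T x)\<close> at most
  a multiple of \<open>norm x\<close>.

  The domination principle and the transitivity of the order use the elementary theory of positive elements
  of a C*-algebra: the spectrum of a selfadjoint element is real and its spectral radius is its norm
  (\<open>selfadjoint_norm_le_spectral_radius\<close>), sums of positive elements are positive, the norm is monotone on
  positive elements, and \<open>a + s\<close> has a selfadjoint square root for positive \<open>a\<close> and \<open>s > 0\<close>.

  For the operators, \<open>(\<Lambda> T)' \<Lambda> T x = T' (\<Lambda>' \<Lambda> T x)\<close> pointwise, and the bounded linear map \<open>T'\<close> can be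
  taken out of the Bochner integral.
\<close>

section \<open>Complex scalars, involution and inverses\<close>

lemma scaleC_zero_left [simp]: "(0::complex) *\<^sub>C x = 0" for x :: "'a::complex_vector"
  using scaleR_scaleC[of 0 x] by simp

lemma scaleC_one [simp]: "(1::complex) *\<^sub>C x = x" for x :: "'a::complex_vector"
  using scaleR_scaleC[of 1 x] by simp

lemma scaleC_zero_right [simp]: "c *\<^sub>C (0::'a::complex_vector) = 0"
  using scaleC_add_right[of c 0 "0::'a"] by simp

lemma scaleC_minus_left: "(- c) *\<^sub>C x = - (c *\<^sub>C x)" for x :: "'a::complex_vector"
  using scaleC_add_left[of c "-c" x] by (simp add: eq_neg_iff_add_eq_0 add.commute)

lemma scaleC_minus_right: "c *\<^sub>C (- x) = - (c *\<^sub>C x)" for x :: "'a::complex_vector"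
  using scaleC_add_right[of c x "-x"] by (simp add: eq_neg_iff_add_eq_0 add.commute)

lemma scaleC_diff_left: "(c - d) *\<^sub>C x = c *\<^sub>C x - d *\<^sub>C x" for x :: "'a::complex_vector"
  using scaleC_add_left[of c "-d" x] by (simp add: scaleC_minus_left)

lemma scaleC_diff_right: "c *\<^sub>C (x - y) = c *\<^sub>C x - c *\<^sub>C y" for x :: "'a::complex_vector"
  using scaleC_add_right[of c x "-y"] by (simp add: scaleC_minus_right)

lemma star_scaleR: "star (r *\<^sub>R a) = r *\<^sub>R star a" for a :: "'a::cstar_algebra"
  by (simp add: scaleR_scaleC star_scaleC)

lemma star_minus: "star (- a) = - star a" for a :: "'a::cstar_algebra"
  using star_scaleR[of "-1" a] by simp

lemma star_diff: "star (a - b) = star a - star b" for a :: "'a::cstar_algebra"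
  using star_add[of a "-b"] by (simp add: star_minus)

lemma star_one [simp]: "star (1::'a::unital_cstar_algebra) = 1"
  by (metis star_star star_mult mult_1_left mult_1_right)

lemma norm_star: "norm (star a) = norm a" for a :: "'a::cstar_algebra"
proof -
  have le: "norm b \<le> norm (star b)" for b :: 'a
  proof (cases "b = 0")
    case False
    have "(norm b)\<^sup>2 \<le> norm (star b) * norm b"
      using norm_mult_ineq[of "star b" b] by (simp add: cstar_identity)
    then show ?thesis using False by (simp add: power2_eq_square)
  qed simp
  show ?thesis using le[of a] le[of "star a"] by (simp add: star_star)
qed

lemma norm_one_le: "norm (1::'a::unital_cstar_algebra) \<le> 1"
proof -
  have "norm (1::'a) = (norm (1::'a))\<^sup>2" using cstar_identity[of "1::'a"] by simp
  then have "norm (1::'a) = 0 \<or> norm (1::'a) = 1" by (simp add: power2_eq_square)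
  then show ?thesis by auto
qed

lemma norm_scaleR_one_le: "norm (r *\<^sub>R (1::'a::unital_cstar_algebra)) \<le> \<bar>r\<bar>"
  using mult_left_mono[OF norm_one_le[where 'a='a], of "\<bar>r\<bar>"] by simp

lemma norm_selfadjoint_square: "selfadjoint a \<Longrightarrow> norm (a * a) = (norm a)\<^sup>2" for a :: "'a::cstar_algebra"
  using cstar_identity[of a] by (simp add: selfadjoint_def)

lemma selfadjoint_add: "selfadjoint a \<Longrightarrow> selfadjoint b \<Longrightarrow> selfadjoint (a + b)"
  and selfadjoint_diff: "selfadjoint a \<Longrightarrow> selfadjoint b \<Longrightarrow> selfadjoint (a - b)"
  and selfadjoint_scaleR: "selfadjoint a \<Longrightarrow> selfadjoint (r *\<^sub>R a)"
  for a b :: "'a::cstar_algebra"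
  by (simp_all add: selfadjoint_def star_add star_diff star_scaleR)

lemma selfadjoint_one: "selfadjoint (1::'a::unital_cstar_algebra)"
  by (simp add: selfadjoint_def)

lemma invertible_elemI:
  assumes "u * a = 1" "a * v = 1" shows "invertible_elem a"
proof -
  have "u = v" using assms by (metis mult.assoc mult_1_left mult_1_right)
  then show ?thesis using assms unfolding invertible_elem_def by blast
qed

lemma invertible_elem_mult:
  assumes "invertible_elem a" "invertible_elem b" shows "invertible_elem (a * b)"
proof -
  obtain u v where "a * u = 1" "u * a = 1" "b * v = 1" "v * b = 1"
    using assms unfolding invertible_elem_def by blast
  then have "(v * u) * (a * b) = 1" "(a * b) * (v * u) = 1"
    by (metis mult.assoc mult_1_left)+
  then show ?thesis by (rule invertible_elemI)
qed

lemma invertible_elem_scaleC: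
  assumes "invertible_elem a" "c \<noteq> 0" shows "invertible_elem (c *\<^sub>C a)"
proof -
  obtain u where "a * u = 1" "u * a = 1" using assms unfolding invertible_elem_def by blast
  then have "((1/c) *\<^sub>C u) * (c *\<^sub>C a) = 1" "(c *\<^sub>C a) * ((1/c) *\<^sub>C u) = 1"
    using assms(2) by (simp_all add: mult_scaleC_left mult_scaleC_right scaleC_scaleC)
  then show ?thesis by (rule invertible_elemI)
qed

lemma invertible_elem_scaleR: "invertible_elem a \<Longrightarrow> r \<noteq> 0 \<Longrightarrow> invertible_elem (r *\<^sub>R a)"
  by (simp add: scaleR_scaleC invertible_elem_scaleC)

lemma invertible_elem_minus: "invertible_elem (- a) \<longleftrightarrow> invertible_elem a"
  using invertible_elem_scaleR[of a "-1"] invertible_elem_scaleR[of "-a" "-1"] by auto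

text \<open>The Neumann series, in the form of a fixed point: a right inverse of \<open>1 - a\<close> is a fixed point of
  the contraction \<open>b \<mapsto> 1 + a * b\<close>, a left inverse one of \<open>b \<mapsto> 1 + b * a\<close>.\<close>
lemma invertible_one_minus:
  fixes a :: "'a::unital_cstar_algebra"
  assumes "norm a < 1" shows "invertible_elem (1 - a)"
proof -
  have "\<exists>!b. 1 + b * a = b"
  proof (rule banach_fix_type[of "norm a"])
    show "\<forall>x y. dist (1 + x * a) (1 + y * a) \<le> norm a * dist x y"
      by (metis add_diff_cancel_left dist_norm left_diff_distrib mult.commute norm_mult_ineq)
  qed (use assms in auto)
  then obtain u where u: "1 + u * a = u" by blast
  have "\<exists>!b. 1 + a * b = b"
  proof (rule banach_fix_type[of "norm a"])
    show "\<forall>x y. dist (1 + a * x) (1 + a * y) \<le> norm a * dist x y"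
      by (metis add_diff_cancel_left dist_norm right_diff_distrib norm_mult_ineq)
  qed (use assms in auto)
  then obtain v where v: "1 + a * v = v" by blast
  show ?thesis
    using u v by (intro invertible_elemI[of u _ v]) (simp_all add: algebra_simps eq_diff_eq diff_eq_eq)
qed

lemma invertible_scaleC_one_minus:
  fixes a :: "'a::unital_cstar_algebra"
  assumes "norm a < cmod c" shows "invertible_elem (c *\<^sub>C 1 - a)"
proof -
  have c: "c \<noteq> 0" using assms by auto
  have "norm ((1/c) *\<^sub>C a) < 1" using assms c by (simp add: norm_scaleC norm_divide divide_simps)
  from invertible_elem_scaleC[OF invertible_one_minus[OF this] c] show ?thesis
    using c by (simp add: scaleC_diff_right scaleC_scaleC)
qed

lemma invertible_scaleR_one_minus:
  fixes a :: "'a::unital_cstar_algebra"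
  assumes "norm a < r" shows "invertible_elem (r *\<^sub>R 1 - a)"
  using invertible_scaleC_one_minus[of a "complex_of_real r"] assms by (simp add: scaleR_scaleC)

section \<open>Spectra of selfadjoint elements\<close>

text \<open>Arens' argument. Let \<open>k = h + \<i> n\<close>. By the C*-identity
  \<open>norm k ^ 2 = norm (h\<^sup>2 + n\<^sup>2) \<le> norm h ^ 2 + n\<^sup>2\<close>, while the number \<open>\<i> (b + n)\<close> has modulus squared
  \<open>b\<^sup>2 + 2 b n + n\<^sup>2\<close>. The cross term makes the latter bigger once \<open>n\<close> is a large number of the sign of
  \<open>b\<close>, so that \<open>\<i> (b + n) - k = \<i> b - h\<close> is invertible.\<close>
lemma selfadjoint_shift_imaginary_invertible:
  fixes h :: "'a::unital_cstar_algebra"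
  assumes h: "selfadjoint h" and b: "b \<noteq> 0"
  shows "invertible_elem (h - (\<i> * complex_of_real b) *\<^sub>C 1)"
proof -
  \<comment> \<open>The choice that makes the cross term 2 b n equal to twice norm h squared plus 2.\<close>
  define n where "n = ((norm h)\<^sup>2 + 1) / b"
  define k where "k = h + (\<i> * complex_of_real n) *\<^sub>C 1"
  have "star k * k = h * h + (n\<^sup>2) *\<^sub>R 1"
    using h unfolding k_def selfadjoint_def
    by (simp add: star_add star_scaleC algebra_simps mult_scaleC_left mult_scaleC_right
        scaleC_scaleC scaleR_scaleC scaleC_minus_left power2_eq_square scaleC_minus_right
        scaleC_diff_right scaleC_add_right)
  then have "(norm k)\<^sup>2 = norm (h * h + (n\<^sup>2) *\<^sub>R 1)" by (metis cstar_identity)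
  also have "\<dots> \<le> norm (h * h) + norm ((n\<^sup>2) *\<^sub>R (1::'a))" by (rule norm_triangle_ineq)
  also have "\<dots> \<le> (norm h)\<^sup>2 + n\<^sup>2"
    using norm_scaleR_one_le[of "n\<^sup>2", where 'a='a] h by (simp add: norm_selfadjoint_square)
  also have "\<dots> < (b + n)\<^sup>2"
  proof -
    have "(b + n)\<^sup>2 = b\<^sup>2 + 2 * ((norm h)\<^sup>2 + 1) + n\<^sup>2"
      using b by (simp add: n_def power2_sum)
    then show ?thesis by (simp add: add_nonneg_pos)
  qed
  finally have "norm k < \<bar>b + n\<bar>" using power2_less_imp_less[of "norm k" "\<bar>b+n\<bar>"] by simp
  then have "norm k < cmod (\<i> * complex_of_real (b + n))" by (simp add: norm_mult del: of_real_add)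
  from invertible_scaleC_one_minus[OF this]
  have "invertible_elem (- ((\<i> * complex_of_real (b + n)) *\<^sub>C 1 - k))"
    by (simp only: invertible_elem_minus)
  moreover have "- ((\<i> * complex_of_real (b + n)) *\<^sub>C 1 - k) = h - (\<i> * complex_of_real b) *\<^sub>C 1"
    by (simp add: k_def distrib_left scaleC_add_left)
  ultimately show ?thesis by simp
qed

lemma selfadjoint_spectrum_real:
  fixes h :: "'a::unital_cstar_algebra"
  assumes h: "selfadjoint h" and c: "Im c \<noteq> 0"
  shows "invertible_elem (h - c *\<^sub>C 1)"
proof -
  have "selfadjoint (h - Re c *\<^sub>R 1)"
    by (intro selfadjoint_diff selfadjoint_scaleR selfadjoint_one h)
  from selfadjoint_shift_imaginary_invertible[OF this c]
  have "invertible_elem (h - (complex_of_real (Re c) *\<^sub>C 1 + (\<i> * complex_of_real (Im c)) *\<^sub>C 1))"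
    by (simp add: scaleR_scaleC algebra_simps)
  then show ?thesis by (metis scaleC_add_left complex_eq)
qed

text \<open>Since the spectrum of a selfadjoint element is real, only the negative reals have to be kept out of
  it.\<close>
lemma positive_elem_iff:
  "positive_elem a \<longleftrightarrow> selfadjoint a \<and> (\<forall>s>0. invertible_elem (a + s *\<^sub>R 1))"
proof
  assume a: "positive_elem a"
  show "selfadjoint a \<and> (\<forall>s>0. invertible_elem (a + s *\<^sub>R 1))"
  proof (intro conjI allI impI)
    show "selfadjoint a" using a by (simp add: positive_elem_def)
    fix s :: real assume "s > 0"
    then have "complex_of_real (-s) \<notin> complex_of_real ` {0..}" by (auto simp del: of_real_minus)
    then have "complex_of_real (-s) \<notin> spectrum a" using a by (auto simp: positive_elem_def)
    then show "invertible_elem (a + s *\<^sub>R 1)"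
      by (simp add: spectrum_def scaleR_scaleC scaleC_minus_left)
  qed
next
  assume a: "selfadjoint a \<and> (\<forall>s>0. invertible_elem (a + s *\<^sub>R 1))"
  have "c \<in> complex_of_real ` {0..}" if c: "c \<in> spectrum a" for c
  proof -
    have "Im c = 0" using c selfadjoint_spectrum_real a by (force simp: spectrum_def)
    then have eq: "c = complex_of_real (Re c)" by (simp add: complex_eq_iff)
    have "a - c *\<^sub>C 1 = a + (- Re c) *\<^sub>R 1"
      by (subst eq) (simp add: scaleR_scaleC scaleC_minus_left)
    then have "\<not> - Re c > 0" using a c by (metis (mono_tags) mem_Collect_eq spectrum_def)
    then show ?thesis using eq by force
  qed
  then show "positive_elem a" using a by (auto simp: positive_elem_def)
qed

lemma norm_mult_mult_le: "norm (a * (b * c)) \<le> norm a * (norm b * norm c)" for a :: "'a::real_normed_algebra"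
  by (rule order_trans[OF norm_mult_ineq mult_left_mono[OF norm_mult_ineq norm_ge_zero]])

text \<open>The identity \<open>F w - F l = (w - l) F w p F l\<close> bounds \<open>F\<close> near each point \<open>l\<close> by twice its norm at \<open>l\<close>;
  compactness of the disc makes the bound uniform.\<close>
lemma resolvent_bounded_on_disc:
  fixes p :: "'a::unital_cstar_algebra"
  assumes F: "\<And>z. cmod z \<le> 1 \<Longrightarrow> (1 - z *\<^sub>C p) * F z = 1 \<and> F z * (1 - z *\<^sub>C p) = 1"
  shows "\<exists>C. \<forall>z. cmod z \<le> 1 \<longrightarrow> norm (F z) \<le> C"
proof (rule ccontr)
  assume "\<not> ?thesis"
  then have "\<forall>n::nat. \<exists>z. cmod z \<le> 1 \<and> norm (F z) > real n"
    by (metis not_le)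
  then obtain z where z: "\<And>n. cmod (z n) \<le> 1" "\<And>n. norm (F (z n)) > real n" by metis
  have "compact (cball (0::complex) 1)" by simp
  then obtain l r where l: "l \<in> cball 0 1" "strict_mono (r::nat\<Rightarrow>nat)" "(z \<circ> r) \<longlonglongrightarrow> l"
    using z(1) by (auto simp: compact_def dest: spec[of _ z])
  have l1: "cmod l \<le> 1" using l(1) by simp
  have bound: "norm (F w) \<le> norm (F l) + cmod (w - l) * (norm p * norm (F l)) * norm (F w)"
    if w: "cmod w \<le> 1" for w
  proof -
    have "F w = F w * ((1 - l *\<^sub>C p) * F l)" using F[OF l1] by simp
    also have "\<dots> = F w * ((1 - w *\<^sub>C p) * F l) + F w * ((w - l) *\<^sub>C p * F l)"
      by (simp add: algebra_simps scaleC_diff_left)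
    also have "\<dots> = F l + F w * ((w - l) *\<^sub>C p * F l)"
      using F[OF w] by (metis mult.assoc mult_1_left)
    finally have "norm (F w) \<le> norm (F l) + norm (F w * ((w - l) *\<^sub>C p * F l))"
      by (metis norm_triangle_ineq)
    also have "norm (F w * ((w - l) *\<^sub>C p * F l)) \<le> norm (F w) * (norm ((w - l) *\<^sub>C p) * norm (F l))"
      by (rule norm_mult_mult_le)
    finally show ?thesis by (simp add: norm_scaleC mult_ac)
  qed
  have "(\<lambda>n. cmod ((z \<circ> r) n - l) * (norm p * norm (F l))) \<longlonglongrightarrow> cmod (l - l) * (norm p * norm (F l))"
    by (intro tendsto_intros l(3))
  then have ev: "eventually (\<lambda>n. cmod ((z \<circ> r) n - l) * (norm p * norm (F l)) < 1/2) sequentially"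
    by (rule order_tendstoD) simp
  obtain N :: nat where N: "2 * norm (F l) \<le> real N" using real_arch_simple by blast
  have "eventually (\<lambda>n. cmod ((z \<circ> r) n - l) * (norm p * norm (F l)) < 1/2 \<and> n \<ge> N) sequentially"
    by (rule eventually_conj[OF ev eventually_ge_at_top])
  then obtain n where "cmod ((z \<circ> r) n - l) * (norm p * norm (F l)) < 1/2 \<and> n \<ge> N"
    using eventually_happens by fastforce
  then have n: "n \<ge> N" "cmod (z (r n) - l) * (norm p * norm (F l)) < 1/2" by simp_all
  have "cmod (z (r n) - l) * (norm p * norm (F l)) * norm (F (z (r n))) \<le> 1/2 * norm (F (z (r n)))"
    by (rule mult_right_mono) (use n in auto)
  then have "norm (F (z (r n))) \<le> 2 * norm (F l)" using bound[OF z(1)[of "r n"]] by simp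
  moreover have "real (r n) \<ge> real N" using n(1) seq_suble[OF l(2), of n] by linarith
  ultimately show False using z(2)[of "r n"] N by linarith
qed

definition mutually_inverse :: "'a::unital_cstar_algebra \<Rightarrow> 'a \<Rightarrow> bool" where
  "mutually_inverse a b \<longleftrightarrow> a * b = 1 \<and> b * a = 1"

text \<open>The partial fraction decomposition
  \<open>1 / (1 - z\<^sup>2 p\<^sup>2) = (1 / (1 - z p) + 1 / (1 + z p)) / 2\<close>.\<close>
lemma mutually_inverse_average:
  fixes p :: "'a::unital_cstar_algebra"
  assumes "mutually_inverse (1 - z *\<^sub>C p) u" "mutually_inverse (1 - (-z) *\<^sub>C p) v"
  shows "mutually_inverse (1 - (z\<^sup>2) *\<^sub>C (p * p)) ((1/2) *\<^sub>R (u + v))"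
proof -
  let ?m = "1 - z *\<^sub>C p" and ?q = "1 + z *\<^sub>C p"
  have e: "1 - (z\<^sup>2) *\<^sub>C (p * p) = ?m * ?q" "1 - (z\<^sup>2) *\<^sub>C (p * p) = ?q * ?m"
    by (simp_all add: algebra_simps mult_scaleC_left mult_scaleC_right scaleC_scaleC power2_eq_square
        scaleC_diff_right scaleC_add_right)
  have m: "?m * u = 1" "u * ?m = 1" "?q * v = 1" "v * ?q = 1"
    using assms by (auto simp: mutually_inverse_def scaleC_minus_left)
  have "?q * ?m * u = ?q" "?m * ?q * v = ?m" using m by (simp_all only: mult.assoc mult_1_right)
  then have "(1 - (z\<^sup>2) *\<^sub>C (p * p)) * (u + v) = ?q + ?m" by (simp only: distrib_left[of _ u v] flip: e)
  moreover have "u * (?m * ?q) = ?q" "v * (?q * ?m) = ?m" using m by (simp_all only: mult_1_left flip: mult.assoc)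
  then have "(u + v) * (1 - (z\<^sup>2) *\<^sub>C (p * p)) = ?q + ?m" by (simp only: distrib_right[of u v] flip: e)
  moreover have "?q + ?m = 2 *\<^sub>R 1" by (simp add: scaleR_2)
  ultimately show ?thesis by (simp add: mutually_inverse_def)
qed

text \<open>Each resolvent of \<open>p\<^sup>2\<close> is an average of two resolvents of \<open>p\<close>, at points of modulus at most \<open>1\<close> again.
  Hence a bound on the variation of the resolvent between the points \<open>z\<close> and \<open>r z\<close> passes
  from \<open>p\<close> to \<open>p\<^sup>2\<close>, with \<open>r\<close> replaced by \<open>r\<^sup>2\<close> and with the same constant \<open>\<eta>\<close>.\<close>
lemma resolvent_difference_dyadic:
  fixes p :: "'a::unital_cstar_algebra"
  assumes "\<And>z. cmod z \<le> 1 \<Longrightarrow> \<exists>u v. mutually_inverse (1 - z *\<^sub>C p) u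
      \<and> mutually_inverse (1 - (complex_of_real r * z) *\<^sub>C p) v \<and> norm (u - v) \<le> \<eta>"
    and "cmod z \<le> 1"
  shows "\<exists>u v. mutually_inverse (1 - z *\<^sub>C p ^ (2 ^ m)) u
      \<and> mutually_inverse (1 - (complex_of_real (r ^ (2 ^ m)) * z) *\<^sub>C p ^ (2 ^ m)) v \<and> norm (u - v) \<le> \<eta>"
  using assms(2)
proof (induction m arbitrary: z)
  case 0
  then show ?case using assms(1) by simp
next
  case (Suc m)
  let ?P = "p ^ (2 ^ m)" and ?R = "complex_of_real (r ^ (2 ^ m))"
  define y where "y = csqrt z"
  have y: "y\<^sup>2 = z" by (simp add: y_def)
  have "cmod y \<le> 1" using Suc.prems power_le_one_iff[of "cmod y" 2] by (simp flip: y norm_power)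
  then have y1: "cmod y \<le> 1" "cmod (-y) \<le> 1" by auto
  obtain u v where uv: "mutually_inverse (1 - y *\<^sub>C ?P) u"
      "mutually_inverse (1 - (?R * y) *\<^sub>C ?P) v" "norm (u - v) \<le> \<eta>" using Suc.IH[OF y1(1)] by blast
  obtain u' v' where uv': "mutually_inverse (1 - (-y) *\<^sub>C ?P) u'"
      "mutually_inverse (1 - (?R * (-y)) *\<^sub>C ?P) v'" "norm (u' - v') \<le> \<eta>" using Suc.IH[OF y1(2)] by blast
  have P: "p ^ (2 ^ Suc m) = ?P * ?P" by (simp add: mult_2 power_add)
  have R: "complex_of_real (r ^ (2 ^ Suc m)) * z = (?R * y)\<^sup>2"
  proof -
    have "r ^ (2 ^ Suc m) = (r ^ (2 ^ m))\<^sup>2" by (simp only: power_Suc2 power_mult)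
    then show ?thesis by (simp only: power_mult_distrib y of_real_power)
  qed
  have 1: "mutually_inverse (1 - z *\<^sub>C p ^ (2 ^ Suc m)) ((1/2) *\<^sub>R (u + u'))"
    using mutually_inverse_average[OF uv(1) uv'(1)] by (simp only: y P)
  have 2: "mutually_inverse (1 - (complex_of_real (r ^ (2 ^ Suc m)) * z) *\<^sub>C p ^ (2 ^ Suc m)) ((1/2) *\<^sub>R (v + v'))"
    unfolding R P by (rule mutually_inverse_average) (use uv(2) uv'(2) in simp_all)
  have "(1/2) *\<^sub>R (u + u') - (1/2) *\<^sub>R (v + v') = (1/2) *\<^sub>R ((u - v) + (u' - v'))"
    by (simp add: algebra_simps)
  then have "norm ((1/2) *\<^sub>R (u + u') - (1/2) *\<^sub>R (v + v')) = (1/2) * norm ((u - v) + (u' - v'))"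
    by simp
  also have "\<dots> \<le> \<eta>" using norm_triangle_ineq[of "u - v" "u' - v'"] uv(3) uv'(3) by simp
  finally show ?case using 1 2 by blast
qed

lemma norm_selfadjoint_dyadic_power:
  fixes p :: "'a::unital_cstar_algebra"
  assumes "selfadjoint p" shows "norm (p ^ (2 ^ m)) = norm p ^ (2 ^ m) \<and> selfadjoint (p ^ (2 ^ m))"
proof (induction m)
  case (Suc m)
  have P: "p ^ (2 ^ Suc m) = p ^ (2 ^ m) * p ^ (2 ^ m)" by (simp add: mult_2 power_add)
  have "norm p ^ (2 ^ Suc m) = (norm p ^ (2 ^ m))\<^sup>2" by (simp only: power_Suc2 power_mult)
  then show ?case using Suc norm_selfadjoint_square[of "p ^ (2 ^ m)"] unfolding P
    by (simp add: selfadjoint_def star_mult)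
qed (simp add: assms)

text \<open>An elementary form of the fact that a selfadjoint element has spectral radius equal to its norm,
  following Rickart's proof of the spectral radius formula. Let \<open>n = 2 ^ k\<close>, so that \<open>norm (p ^ n) = 1\<close>
  by the C*-identity. If the resolvent exists on the whole disc, it is bounded there and hence varies
  little between \<open>z\<close> and \<open>r z\<close> for some \<open>r < 1\<close>. By \<open>resolvent_difference_dyadic\<close>, the inverse \<open>u\<close> of \<open>1 - p ^ n\<close> is
  then close to the inverse \<open>v\<close> of \<open>1 - r ^ n p ^ n\<close>, uniformly in \<open>k\<close>. For large \<open>k\<close> the element
  \<open>r ^ n p ^ n\<close> is small, so \<open>v\<close> is close to \<open>1\<close>; then so is \<open>u\<close>, which forces \<open>p ^ n\<close> to be small.\<close>
lemma selfadjoint_norm_one_not_invertible_on_disc: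
  fixes p :: "'a::unital_cstar_algebra"
  assumes p: "selfadjoint p" "norm p = 1"
    and inv: "\<And>z. cmod z \<le> 1 \<Longrightarrow> invertible_elem (1 - z *\<^sub>C p)"
  shows False
proof -
  obtain F where F: "\<And>z. cmod z \<le> 1 \<Longrightarrow> (1 - z *\<^sub>C p) * F z = 1 \<and> F z * (1 - z *\<^sub>C p) = 1"
    using inv unfolding invertible_elem_def by metis
  obtain C where C: "\<And>z. cmod z \<le> 1 \<Longrightarrow> norm (F z) \<le> C"
    using resolvent_bounded_on_disc[OF F] by blast
  have C0: "C \<ge> 0" using order_trans[OF norm_ge_zero C[of 0]] by simp
  define D where "D = 8 * C\<^sup>2 + 8"
  have D: "D \<ge> 1" "8 * C\<^sup>2 \<le> D" by (simp_all add: D_def add_increasing)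
  define r where "r = 1 - 1 / D"
  have r: "0 \<le> r" "r < 1" using D(1) by (simp_all add: r_def)
  have "(1 - r) * C\<^sup>2 = C\<^sup>2 / D" by (simp add: r_def)
  also have "\<dots> \<le> 1/8" using D by (simp add: divide_le_eq)
  finally have rC: "(1 - r) * C\<^sup>2 \<le> 1/8" .
  \<comment> \<open>The difference of the resolvents at z and r z is F z ((z - r z) p) F (r z), of norm at most
    (1 - r) C squared.\<close>
  have base: "\<exists>u v. mutually_inverse (1 - z *\<^sub>C p) u
      \<and> mutually_inverse (1 - (complex_of_real r * z) *\<^sub>C p) v \<and> norm (u - v) \<le> 1/8"
    if z: "cmod z \<le> 1" for z
  proof -
    let ?w = "complex_of_real r * z"
    have w: "cmod ?w \<le> 1" using z r by (simp add: norm_mult mult_le_one)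
    have "F z - F ?w = F z * ((1 - ?w *\<^sub>C p) * F ?w) - (F z * (1 - z *\<^sub>C p)) * F ?w"
      using F[OF z] F[OF w] by simp
    also have "\<dots> = F z * (((z - ?w) *\<^sub>C p) * F ?w)"
      by (simp add: algebra_simps scaleC_diff_left)
    finally have "norm (F z - F ?w) \<le> norm (F z) * (norm ((z - ?w) *\<^sub>C p) * norm (F ?w))"
      by (simp add: norm_mult_mult_le)
    moreover have "norm ((z - ?w) *\<^sub>C p) \<le> 1 - r"
    proof -
      have "z - ?w = complex_of_real (1 - r) * z" by (simp add: algebra_simps)
      then show ?thesis using z r mult_left_le[of "cmod z" "1 - r"]
        by (simp add: norm_scaleC p(2) norm_mult del: of_real_diff)
    qed
    then have "norm (F z) * (norm ((z - ?w) *\<^sub>C p) * norm (F ?w)) \<le> C * ((1 - r) * C)"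
      using C[OF z] C[OF w] r C0 by (intro mult_mono) auto
    moreover have "C * ((1 - r) * C) \<le> 1/8" using rC by (simp add: power2_eq_square mult.left_commute)
    ultimately have "norm (F z - F ?w) \<le> 1/8" by linarith
    then show ?thesis using F[OF z] F[OF w] unfolding mutually_inverse_def by blast
  qed
  obtain k where k: "r ^ k < 1/10" using real_arch_pow_inv[of "1/10" r] r by auto
  define n :: nat where "n = 2 ^ k"
  have "k \<le> n" by (simp add: n_def less_imp_le)
  then have rn: "r ^ n < 1/10" using k power_decreasing[of k n r] r by simp
  obtain u v where uv: "mutually_inverse (1 - p ^ n) u"
      "mutually_inverse (1 - complex_of_real (r ^ n) *\<^sub>C p ^ n) v" "norm (u - v) \<le> 1/8"
    using resolvent_difference_dyadic[OF base, where z=1 and m=k] by (auto simp: n_def)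
  have pn: "norm (p ^ n) = 1" using norm_selfadjoint_dyadic_power[OF p(1), of k] p(2) by (simp add: n_def)
  define q where "q = complex_of_real (r ^ n) *\<^sub>C p ^ n"
  have q: "norm q \<le> 1/10" using rn r pn by (simp add: q_def norm_scaleC norm_power)
  have diff_swap: "x - y = z \<Longrightarrow> x - z = y" for x y z :: 'a by (erule subst) simp
  have "v - q * v = 1" using uv(2) by (simp add: mutually_inverse_def q_def left_diff_distrib)
  then have v: "v - 1 = q * v" by (rule diff_swap)
  have "norm (v - 1) \<le> 1/10 * norm v"
    unfolding v by (rule order_trans[OF norm_mult_ineq]) (rule mult_right_mono[OF q norm_ge_zero])
  moreover have "norm v \<le> norm (v - 1) + norm (1::'a)"
    using norm_triangle_ineq[of "v - 1" 1] by simp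
  ultimately have v1: "norm (v - 1) \<le> 1/9" using norm_one_le[where 'a='a] by linarith
  have "norm (u - 1) \<le> norm (u - v) + norm (v - 1)" using norm_triangle_ineq[of "u - v" "v - 1"] by simp
  then have u1: "norm (u - 1) < 1/4" using uv(3) v1 by linarith
  have "u - p ^ n * u = 1" using uv(1) by (simp add: mutually_inverse_def left_diff_distrib)
  moreover have "(u - 1) - p ^ n * (u - 1) = (u - p ^ n * u) - 1 + p ^ n" by (simp add: algebra_simps)
  ultimately have "p ^ n = (u - 1) - p ^ n * (u - 1)" by simp
  then have "norm (p ^ n) = norm ((u - 1) - p ^ n * (u - 1))" by (rule arg_cong)
  also have "\<dots> \<le> norm (u - 1) + norm (p ^ n * (u - 1))" by (rule norm_triangle_ineq4)
  also have "norm (p ^ n * (u - 1)) \<le> norm (u - 1)" using norm_mult_ineq[of "p ^ n" "u - 1"] pn by simp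
  finally show False using u1 pn by simp
qed

text \<open>If \<open>norm h > s\<close>, rescale \<open>h\<close> to norm \<open>1\<close>. A nonzero \<open>z\<close> in the unit disc then corresponds to the point
  \<open>c = norm h / z\<close> with \<open>cmod c \<ge> norm h\<close>, at which \<open>h - c\<close> is invertible: by assumption for real \<open>c\<close>,
  and because the spectrum is real otherwise. So the resolvent exists on the whole disc.\<close>
lemma selfadjoint_norm_le_spectral_radius:
  fixes h :: "'a::unital_cstar_algebra"
  assumes h: "selfadjoint h" and "s \<ge> 0"
    and inv: "\<And>r. r > s \<Longrightarrow> invertible_elem (h - r *\<^sub>R 1) \<and> invertible_elem (h + r *\<^sub>R 1)"
  shows "norm h \<le> s"
proof (rule ccontr)
  assume n: "\<not> norm h \<le> s"
  then have N: "norm h > 0" using \<open>s \<ge> 0\<close> by linarith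
  have inv': "invertible_elem (1 - z *\<^sub>C ((1 / norm h) *\<^sub>R h))" if z: "cmod z \<le> 1" for z
  proof (cases "z = 0")
    case True
    then show ?thesis using invertible_one_minus[of "0::'a"] by simp
  next
    case False
    define c where "c = complex_of_real (norm h) / z"
    have c: "cmod c \<ge> norm h" "c \<noteq> 0" using z N False by (auto simp: c_def norm_divide divide_simps)
    have "invertible_elem (h - c *\<^sub>C 1)"
    proof (cases "Im c = 0")
      case True
      then have c': "c = complex_of_real (Re c)" by (simp add: complex_eq_iff)
      then have "\<bar>Re c\<bar> > s" using c n by (metis norm_of_real not_le order_less_le_trans)
      then have "Re c > s \<or> - Re c > s" by linarith
      then have "invertible_elem (h - Re c *\<^sub>R 1)" using inv[of "Re c"] inv[of "- Re c"] by auto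
      then show ?thesis by (metis c' scaleR_scaleC)
    qed (rule selfadjoint_spectrum_real[OF h])
    then have "invertible_elem ((- 1 / c) *\<^sub>C (h - c *\<^sub>C 1))" by (rule invertible_elem_scaleC) (use c in simp)
    moreover have "(- 1 / c) *\<^sub>C (h - c *\<^sub>C 1) = 1 - z *\<^sub>C ((1 / norm h) *\<^sub>R h)"
      using c(2) False N by (simp add: scaleC_diff_right scaleC_scaleC scaleR_scaleC scaleC_minus_left)
         (simp add: c_def)
    ultimately show ?thesis by simp
  qed
  show False
    by (rule selfadjoint_norm_one_not_invertible_on_disc[OF _ _ inv']) (use h N in \<open>auto intro: selfadjoint_scaleR\<close>)
qed

section \<open>Positive elements\<close>

text \<open>Together with its converse below, this describes positivity by the norm: a selfadjoint \<open>a\<close> is positive if and only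
  if it lies in the ball of radius \<open>t\<close> around \<open>t 1\<close>, for any \<open>t \<ge> norm a\<close>. The balls are convex,
  which is what makes sums of positive elements positive.\<close>
lemma norm_shift_le_of_positive:
  assumes a: "positive_elem a" and t: "norm a \<le> t"
  shows "norm (t *\<^sub>R 1 - a) \<le> t"
proof (rule selfadjoint_norm_le_spectral_radius)
  show "selfadjoint (t *\<^sub>R 1 - a)" using a
    by (auto intro!: selfadjoint_diff selfadjoint_scaleR selfadjoint_one simp: positive_elem_iff)
  show "t \<ge> 0" using t norm_ge_zero order_trans by blast
  fix r assume r: "r > t"
  have "invertible_elem (a + (r - t) *\<^sub>R 1)" using a r by (simp add: positive_elem_iff)
  then have "invertible_elem (- (a + (r - t) *\<^sub>R 1))" by (simp only: invertible_elem_minus)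
  moreover have "invertible_elem ((t + r) *\<^sub>R 1 - a)"
    by (rule invertible_scaleR_one_minus) (use t r \<open>0 \<le> t\<close> in linarith)
  ultimately show "invertible_elem (t *\<^sub>R 1 - a - r *\<^sub>R 1) \<and> invertible_elem (t *\<^sub>R 1 - a + r *\<^sub>R 1)"
    by (simp add: algebra_simps)
qed

lemma positive_of_norm_shift_le:
  fixes a :: "'a::unital_cstar_algebra"
  assumes a: "selfadjoint a" and t: "norm (t *\<^sub>R 1 - a) \<le> t"
  shows "positive_elem a"
  unfolding positive_elem_iff
proof (intro conjI allI impI a)
  fix s :: real assume "s > 0"
  then have "invertible_elem ((t + s) *\<^sub>R 1 - (t *\<^sub>R 1 - a))"
    by (intro invertible_scaleR_one_minus) (use t in linarith)
  then show "invertible_elem (a + s *\<^sub>R 1)" by (simp add: algebra_simps)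
qed

lemma positive_elem_add:
  assumes "positive_elem a" "positive_elem b"
  shows "positive_elem (a + b)"
proof (rule positive_of_norm_shift_le)
  show "selfadjoint (a + b)" using assms by (simp add: positive_elem_def selfadjoint_add)
  have "(norm a + norm b) *\<^sub>R 1 - (a + b) = (norm a *\<^sub>R 1 - a) + (norm b *\<^sub>R 1 - b)"
    by (simp add: algebra_simps)
  then show "norm ((norm a + norm b) *\<^sub>R 1 - (a + b)) \<le> norm a + norm b"
    using norm_triangle_mono[OF norm_shift_le_of_positive[OF assms(1) order_refl]
        norm_shift_le_of_positive[OF assms(2) order_refl]] by (simp only:)
qed

lemma positive_elem_scaleR:
  assumes "positive_elem a" "r > 0" shows "positive_elem (r *\<^sub>R a)"
  unfolding positive_elem_iff
proof (intro conjI allI impI)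
  show "selfadjoint (r *\<^sub>R a)" using assms by (simp add: positive_elem_def selfadjoint_scaleR)
  fix s :: real assume "s > 0"
  then have "invertible_elem (r *\<^sub>R (a + (s / r) *\<^sub>R 1))"
    using assms by (intro invertible_elem_scaleR) (simp_all add: positive_elem_iff)
  then show "invertible_elem (r *\<^sub>R a + s *\<^sub>R 1)" using assms(2) by (simp add: scaleR_add_right)
qed

lemma cstar_le_trans:
  assumes "a \<preceq> b" "b \<preceq> c" shows "a \<preceq> c"
  using assms positive_elem_add[of "c - b" "b - a"] by (simp add: cstar_le_def)

lemma positive_norm_shift:
  fixes b :: "'a::unital_cstar_algebra"
  assumes "selfadjoint b" shows "positive_elem (norm b *\<^sub>R 1 - b)"
  unfolding positive_elem_iff
proof (intro conjI allI impI)
  show "selfadjoint (norm b *\<^sub>R 1 - b)"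
    by (intro selfadjoint_diff selfadjoint_scaleR selfadjoint_one assms)
  fix s :: real assume "s > 0"
  then have "invertible_elem ((norm b + s) *\<^sub>R 1 - b)" by (intro invertible_scaleR_one_minus) simp
  then show "invertible_elem (norm b *\<^sub>R 1 - b + s *\<^sub>R 1)" by (simp add: algebra_simps)
qed

text \<open>With \<open>t = norm b\<close>, the element \<open>t - a = (t - b) + (b - a)\<close> is positive, so that the spectrum of \<open>a\<close>
  lies between \<open>0\<close> and \<open>t\<close>.\<close>
lemma norm_mono_positive:
  assumes a: "positive_elem a" and ab: "positive_elem (b - a)"
  shows "norm a \<le> norm b"
proof (rule selfadjoint_norm_le_spectral_radius)
  show sa: "selfadjoint a" using a by (simp add: positive_elem_def)
  have "selfadjoint ((b - a) + a)" by (intro selfadjoint_add sa) (use ab in \<open>simp add: positive_elem_def\<close>)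
  then have "selfadjoint b" by simp
  from positive_elem_add[OF positive_norm_shift[OF this] ab]
  have p: "positive_elem (norm b *\<^sub>R 1 - a)" by simp
  fix r assume r: "r > norm b"
  have "invertible_elem (norm b *\<^sub>R 1 - a + (r - norm b) *\<^sub>R 1)" using p r by (simp add: positive_elem_iff)
  then have "invertible_elem (- (r *\<^sub>R 1 - a))" by (simp only: invertible_elem_minus) (simp add: algebra_simps)
  moreover have "r > 0" using r norm_ge_zero[of b] by linarith
  ultimately show "invertible_elem (a - r *\<^sub>R 1) \<and> invertible_elem (a + r *\<^sub>R 1)"
    using a by (simp add: positive_elem_iff)
qed simp

text \<open>For \<open>s > 0\<close>, \<open>e\<^sup>2 + s = (e - \<i> sqrt s) (e + \<i> sqrt s)\<close> is a product of invertible elements, because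
  the spectrum of \<open>e\<close> is real.\<close>
lemma positive_elem_square:
  assumes e: "selfadjoint e" shows "positive_elem (e * e)"
  unfolding positive_elem_iff
proof (intro conjI allI impI)
  show "selfadjoint (e * e)" using e by (simp add: selfadjoint_def star_mult)
  fix s :: real assume s: "s > 0"
  let ?c = "\<i> * complex_of_real (sqrt s)"
  have "invertible_elem ((e - ?c *\<^sub>C 1) * (e - (- ?c) *\<^sub>C 1))"
    by (intro invertible_elem_mult selfadjoint_spectrum_real e) (use s in auto)
  moreover have "(e - ?c *\<^sub>C 1) * (e - (- ?c) *\<^sub>C 1) = e * e + s *\<^sub>R 1"
  proof -
    have "?c * ?c = - complex_of_real s"
      using s by (simp add: mult.assoc[symmetric] complex_eq_iff)
    then show ?thesis
      by (simp add: algebra_simps mult_scaleC_left mult_scaleC_right scaleC_minus_left scaleC_minus_right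
          scaleC_scaleC scaleR_scaleC scaleC_diff_right scaleC_add_right)
  qed
  ultimately show "invertible_elem (e * e + s *\<^sub>R 1)" by simp
qed

text \<open>The equation \<open>(1 - y)\<^sup>2 = 1 - x\<close> says \<open>y = (x + y\<^sup>2) / 2\<close>. The right-hand side maps the ball of radius
  \<open>\<rho> = 1 - sqrt (1 - norm x)\<close> into itself and contracts it by the factor \<open>\<rho> < 1\<close>. The adjoint of
  a fixed point is a fixed point as well, so that uniqueness makes \<open>y\<close> selfadjoint.\<close>
lemma sqrt_one_minus:
  fixes x :: "'a::unital_cstar_algebra"
  assumes x: "selfadjoint x" "norm x < 1"
  obtains y where "selfadjoint y" "(1 - y) * (1 - y) = 1 - x"
proof -
  define \<rho> where "\<rho> = 1 - sqrt (1 - norm x)"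
  have \<rho>: "0 \<le> \<rho>" "\<rho> < 1" "(norm x + \<rho>\<^sup>2) / 2 = \<rho>"
    using x(2) by (auto simp: \<rho>_def power2_diff)
  define f where "f y = (1/2) *\<^sub>R (x + y * y)" for y
  have "\<exists>!y\<in>cball 0 \<rho>. f y = y"
  proof (rule Banach_fix[of _ \<rho>])
    show "complete (cball (0::'a) \<rho>)" by (simp add: complete_eq_closed)
    show "f ` cball 0 \<rho> \<subseteq> cball 0 \<rho>"
    proof (rule image_subsetI)
      fix y :: 'a assume "y \<in> cball 0 \<rho>"
      then have y: "norm y \<le> \<rho>" by simp
      have "norm (x + y * y) \<le> norm x + norm y * norm y"
        by (meson norm_triangle_le add_left_mono norm_mult_ineq)
      also have "norm y * norm y \<le> \<rho>\<^sup>2" using y \<rho> by (simp add: power2_eq_square mult_mono)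
      finally have "norm (x + y * y) / 2 \<le> \<rho>" using \<rho>(3) by simp
      then show "f y \<in> cball 0 \<rho>" by (simp add: f_def del: scaleR_add_right)
    qed
    fix y z :: 'a assume yz: "y \<in> cball 0 \<rho>" "z \<in> cball 0 \<rho>"
    have "f y - f z = (1/2) *\<^sub>R (y * (y - z) + (y - z) * z)"
      by (simp add: f_def algebra_simps)
    then have "norm (f y - f z) = norm (y * (y - z) + (y - z) * z) / 2" by (simp del: scaleR_add_right)
    also have "\<dots> \<le> (norm y * norm (y - z) + norm (y - z) * norm z) / 2"
      by (intro divide_right_mono norm_triangle_mono norm_mult_ineq) auto
    also have "\<dots> \<le> (\<rho> * norm (y - z) + norm (y - z) * \<rho>) / 2"
      using yz \<rho>(1) by (intro divide_right_mono add_mono mult_mono) auto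
    finally show "dist (f y) (f z) \<le> \<rho> * dist y z" by (simp add: dist_norm)
  qed (use \<rho> in auto)
  then obtain y where y: "norm y \<le> \<rho>" "f y = y"
    and uniq: "\<And>z. norm z \<le> \<rho> \<Longrightarrow> f z = z \<Longrightarrow> z = y"
    unfolding mem_cball_0 by blast
  have "f (star y) = star (f y)"
    using x(1) by (simp only: f_def star_scaleR star_add star_mult selfadjoint_def)
  then have "star y = y" by (intro uniq) (use y in \<open>simp_all add: norm_star\<close>)
  moreover have "(1 - y) * (1 - y) = 1 - x"
  proof -
    have "2 *\<^sub>R y = x + y * y" by (subst y(2)[symmetric]) (simp add: f_def)
    then have x_eq: "x = y + y - y * y" by (simp add: scaleR_2)
    show ?thesis unfolding x_eq by (simp add: algebra_simps)
  qed
  ultimately show thesis using that by (simp add: selfadjoint_def)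
qed

text \<open>With \<open>t = norm a + s\<close> the element \<open>(a + s) / t\<close> is \<open>1 - x\<close> for some \<open>x\<close> of norm at most
  \<open>norm a / t < 1\<close>.\<close>
lemma sqrt_positive_shift:
  assumes a: "positive_elem a" and s: "s > 0"
  obtains d where "selfadjoint d" "d * d = a + s *\<^sub>R 1"
proof -
  define t where "t = norm a + s"
  have t: "t > 0" using s by (simp add: t_def add_nonneg_pos)
  define x where "x = (1/t) *\<^sub>R (norm a *\<^sub>R 1 - a)"
  have sa: "selfadjoint x" unfolding x_def using a
    by (intro selfadjoint_diff selfadjoint_scaleR selfadjoint_one) (simp add: positive_elem_def)
  have "norm (norm a *\<^sub>R 1 - a) < t"
    using norm_shift_le_of_positive[OF a order_refl] s by (simp add: t_def)
  then have "norm x < 1" using t by (simp add: x_def)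
  from sqrt_one_minus[OF sa this] obtain y where y: "selfadjoint y" "(1 - y) * (1 - y) = 1 - x" .
  show thesis
  proof (rule that)
    show "selfadjoint (sqrt t *\<^sub>R (1 - y))"
      by (intro selfadjoint_diff selfadjoint_scaleR selfadjoint_one y)
    have "(sqrt t *\<^sub>R (1 - y)) * (sqrt t *\<^sub>R (1 - y)) = t *\<^sub>R ((1 - y) * (1 - y))"
      using t by (simp only: mult_scaleR_left mult_scaleR_right scaleR_scaleR) simp
    also have "\<dots> = a + s *\<^sub>R 1"
      using t unfolding y(2) by (simp add: x_def scaleR_diff_right) (simp add: t_def algebra_simps)
    finally show "(sqrt t *\<^sub>R (1 - y)) * (sqrt t *\<^sub>R (1 - y)) = a + s *\<^sub>R 1" .
  qed
qed

section \<open>Hilbert modules and adjointable operators\<close>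

context hilbert_module
begin

lemma ip_add_right: "ip x (y + z) = ip x y + ip x z"
  by (subst (1 2 3) ip_commute) (simp add: ip_add_left star_add)

lemma ip_act_right: "ip x (act a y) = ip x y * star a"
  by (subst (1 2) ip_commute) (simp add: ip_act_left star_mult)

lemma scaleC_eq_act: "c *\<^sub>C x = act (c *\<^sub>C 1) x"
  by (simp add: act_scaleC_left act_one)

lemma ip_scaleC_left: "ip (c *\<^sub>C x) y = c *\<^sub>C ip x y"
  by (simp add: scaleC_eq_act[of c x] ip_act_left mult_scaleC_left)

lemma ip_scaleC_right: "ip x (c *\<^sub>C y) = cnj c *\<^sub>C ip x y"
  by (simp add: scaleC_eq_act[of c y] ip_act_right star_scaleC mult_scaleC_right)

lemma ip_scaleR_left: "ip (r *\<^sub>R x) y = r *\<^sub>R ip x y"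
  by (simp add: scaleR_scaleC ip_scaleC_left)

lemma ip_scaleR_right: "ip x (r *\<^sub>R y) = r *\<^sub>R ip x y"
  by (simp add: scaleR_scaleC ip_scaleC_right)

lemma act_scaleR_right: "act a (r *\<^sub>R x) = r *\<^sub>R act a x"
  by (simp add: scaleR_scaleC act_scaleC_right)

lemma ip_act_act: "ip (act a x) (act a x) = a * ip x x * star a"
  by (simp add: ip_act_left ip_act_right mult.assoc)

lemma selfadjoint_conjugate_ip: "selfadjoint (a * ip x x * star a)"
  using ip_positive[of "act a x"] by (simp add: positive_elem_def ip_act_act)

lemma norm_ip_self: "norm (ip x x) = (norm x)\<^sup>2"
  by (simp add: norm_eq_sqrt_ip[of x])

lemma ip_eqI_left: "(\<And>y. ip x y = ip z y) \<Longrightarrow> x = z"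
  by (rule ip_eqI) (metis ip_commute)

text \<open>For unit vectors, polarization writes \<open>4 ip u v\<close> as a
  combination of the four elements \<open>ip (u + c v) (u + c v)\<close> with \<open>c\<^sup>4 = 1\<close>, and each of these has norm at
  most \<open>(1 + 1)\<^sup>2\<close> by the triangle inequality in the module.\<close>
lemma norm_ip_le: "norm (ip x y) \<le> 4 * norm x * norm y"
proof (cases "x = 0 \<or> y = 0")
  case True
  have "ip 0 y = 0" "ip x 0 = 0" using ip_scaleR_left[of 0 0 y] ip_scaleR_right[of x 0 0] by simp_all
  then show ?thesis using True by auto
next
  case False
  have unit: "norm (ip u v) \<le> 4" if u: "norm u = 1" and v: "norm v = 1" for u v
  proof -
    have q: "norm (ip (u + c *\<^sub>C v) (u + c *\<^sub>C v)) \<le> 4" if c: "cmod c = 1" for c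
    proof -
      have "norm (u + c *\<^sub>C v) \<le> 2" using norm_triangle_ineq[of u "c *\<^sub>C v"] u v c by (simp add: norm_scaleC)
      then have "(norm (u + c *\<^sub>C v))\<^sup>2 \<le> 2\<^sup>2" by (intro power_mono) auto
      then show ?thesis by (simp add: norm_ip_self)
    qed
    define P where "P c = ip (u + c *\<^sub>C v) (u + c *\<^sub>C v)" for c
    have P: "P c = ip u u + cnj c *\<^sub>C ip u v + c *\<^sub>C ip v u + (c * cnj c) *\<^sub>C ip v v" for c
      by (simp add: P_def ip_add_left ip_add_right ip_scaleC_left ip_scaleC_right scaleC_scaleC
          scaleC_add_right algebra_simps)
    have "4 *\<^sub>C ip u v = P 1 + (-1) *\<^sub>C P (-1) + \<i> *\<^sub>C P \<i> + (-\<i>) *\<^sub>C P (-\<i>)"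
    proof -
      have "4 *\<^sub>C ip u v = (1 + 1 + 1 + 1) *\<^sub>C ip u v" by simp
      also have "\<dots> = ip u v + ip u v + ip u v + ip u v" by (simp only: scaleC_add_left scaleC_one)
      also have "\<dots> = P 1 + (-1) *\<^sub>C P (-1) + \<i> *\<^sub>C P \<i> + (-\<i>) *\<^sub>C P (-\<i>)"
        unfolding P by (simp add: scaleC_add_right scaleC_scaleC scaleC_minus_left scaleC_minus_right scaleC_diff_right)
      finally show ?thesis .
    qed
    then have "norm (4 *\<^sub>C ip u v) = norm (P 1 + (-1) *\<^sub>C P (-1) + \<i> *\<^sub>C P \<i> + (-\<i>) *\<^sub>C P (-\<i>))" by simp
    also have "\<dots> \<le> norm (P 1) + norm ((-1) *\<^sub>C P (-1)) + norm (\<i> *\<^sub>C P \<i>) + norm ((-\<i>) *\<^sub>C P (-\<i>))"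
      by (intro norm_triangle_mono order_refl)
    also have "\<dots> \<le> 16" using q[of 1] q[of "-1"] q[of \<i>] q[of "-\<i>"] by (simp add: norm_scaleC P_def)
    finally show ?thesis by (simp add: norm_scaleC)
  qed
  let ?u = "(1 / norm x) *\<^sub>R x" and ?v = "(1 / norm y) *\<^sub>R y"
  have "norm (ip ?u ?v) \<le> 4" by (rule unit) (use False in auto)
  then show ?thesis using False by (simp add: ip_scaleR_left ip_scaleR_right divide_simps mult_ac)
qed

text \<open>Norm estimates at all rescaled vectors \<open>act e x\<close> carry the order information. Let \<open>a = ip (G x) (G x)\<close>, \<open>f = ip (F x) (F x)\<close> and \<open>a + s = d\<^sup>2\<close> with \<open>e\<close> the inverse of \<open>d\<close>. Replacing
  \<open>x\<close> by \<open>act e x\<close> turns \<open>a\<close> into \<open>e a e = 1 - s e\<^sup>2\<close>, of norm at most \<open>1\<close>, and \<open>f\<close> into \<open>e f e\<close>, whose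
  norm is therefore less than \<open>1\<close>. Hence \<open>a - f + s = d (1 - e f e) d\<close> is invertible for every \<open>s > 0\<close>.\<close>
lemma ip_self_le_of_norm_le:
  assumes F: "\<And>a x. F (act a x) = act a (F x)" and G: "\<And>a x. G (act a x) = act a (G x)"
    and q: "0 \<le> q" "q < 1" "\<And>x. norm (F x) \<le> q * norm (G x)"
  shows "positive_elem (ip (G x) (G x) - ip (F x) (F x))"
  unfolding positive_elem_iff
proof (intro conjI allI impI)
  let ?a = "ip (G x) (G x)" and ?f = "ip (F x) (F x)"
  show "selfadjoint (?a - ?f)" using ip_positive by (intro selfadjoint_diff) (simp_all add: positive_elem_def)
  fix s :: real assume s: "s > 0"
  obtain d where d: "selfadjoint d" "d * d = ?a + s *\<^sub>R 1" using sqrt_positive_shift[OF ip_positive s] .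
  have "invertible_elem (d * d)" using ip_positive[of "G x"] s by (simp add: d(2) positive_elem_iff)
  then obtain v where "(v * d) * d = 1" "d * (d * v) = 1"
    unfolding invertible_elem_def by (metis mult.assoc)
  then have inv_d: "invertible_elem d" by (rule invertible_elemI)
  then obtain e where e: "d * e = 1" "e * d = 1" unfolding invertible_elem_def by blast
  have "star e * d = 1" using arg_cong[OF e(1), of star] d(1) by (simp add: star_mult selfadjoint_def)
  then have se: "star e = e" using e(1) by (metis mult.assoc mult_1_left mult_1_right)
  let ?y = "act e x"
  have "ip (G ?y) (G ?y) = e * ?a * e" by (simp add: G ip_act_act se)
  also have "?a = d * d - s *\<^sub>R 1" by (simp add: d(2))
  also have "e * (d * d - s *\<^sub>R 1) * e = (e * d) * (d * e) - s *\<^sub>R (e * e)"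
    by (simp add: algebra_simps)
  finally have G1: "ip (G ?y) (G ?y) = 1 - s *\<^sub>R (e * e)" by (simp add: e)
  have "positive_elem (s *\<^sub>R (e * e))"
    using s se by (intro positive_elem_scaleR positive_elem_square) (simp_all add: selfadjoint_def)
  then have "norm (ip (G ?y) (G ?y)) \<le> norm (1::'a)"
    by (intro norm_mono_positive ip_positive) (simp add: G1)
  then have "(norm (G ?y))\<^sup>2 \<le> 1" using norm_one_le[where 'a='a] by (simp add: norm_ip_self)
  then have "norm (G ?y) \<le> 1" by (simp add: power_le_one_iff)
  then have "norm (F ?y) < 1" using q(3)[of ?y] mult_left_le[of "norm (G ?y)" q] q(1,2) by linarith
  then have "norm (ip (F ?y) (F ?y)) < 1" by (simp add: norm_ip_self power_less_one_iff abs_square_less_1)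
  then have "norm (e * ?f * e) < 1" by (simp add: F ip_act_act se)
  then have "invertible_elem (d * (1 - e * ?f * e) * d)"
    by (intro invertible_elem_mult invertible_one_minus inv_d)
  moreover have "d * (1 - e * ?f * e) * d = d * d - (d * e) * ?f * (e * d)"
    by (simp add: algebra_simps)
  ultimately show "invertible_elem (?a - ?f + s *\<^sub>R 1)"
    by (simp add: e d(2) algebra_simps)
qed

lemma ip_self_dominated:
  assumes F: "\<And>a x. F (act a x) = act a (F x)" and G: "\<And>a x. G (act a x) = act a (G x)"
    and c: "\<And>x. norm (F x) \<le> c * norm (G x)" "c \<ge> 0"
  obtains \<epsilon> where "\<epsilon> > 0" "\<And>x. positive_elem (ip (G x) (G x) - \<epsilon>\<^sup>2 *\<^sub>R ip (F x) (F x))"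
proof
  let ?\<epsilon> = "1 / (c + 1)"
  show "?\<epsilon> > 0" using c(2) by simp
  fix x
  have "positive_elem (ip (G x) (G x) - ip (?\<epsilon> *\<^sub>R F x) (?\<epsilon> *\<^sub>R F x))"
  proof (rule ip_self_le_of_norm_le[where F="\<lambda>x. ?\<epsilon> *\<^sub>R F x" and q="c / (c + 1)"])
    show "norm (?\<epsilon> *\<^sub>R F y) \<le> c / (c + 1) * norm (G y)" for y
      using c by (simp add: divide_simps)
  qed (use c in \<open>simp_all add: F G act_scaleR_right\<close>)
  then show "positive_elem (ip (G x) (G x) - ?\<epsilon>\<^sup>2 *\<^sub>R ip (F x) (F x))"
    by (simp only: ip_scaleR_left ip_scaleR_right scaleR_scaleR power2_eq_square)
qed

lemma bounded_linear_ip_left: "bounded_linear (\<lambda>x. ip x y)"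
  by (rule bounded_linear_intro[where K="4 * norm y"])
     (use norm_ip_le[of _ y] in \<open>simp_all add: ip_add_left ip_scaleR_left mult_ac\<close>)

text \<open>The sets on which the estimate holds with the constant \<open>n\<close> are closed and cover the module. By Baire's
  theorem one of them contains a ball, and translating and scaling that ball gives \<open>m\<close>.\<close>
lemma ip_uniform_boundedness:
  assumes "\<And>u. \<exists>n::real. \<forall>i. norm (ip u (g i)) \<le> n * c i" and c: "\<And>i. c i \<ge> 0"
  obtains m where "m \<ge> 0" "\<And>u i. norm (ip u (g i)) \<le> m * norm u * c i"
proof -
  define E where "E n = {u. \<forall>i. norm (ip u (g i)) \<le> real n * c i}" for n :: nat
  have cl: "closed (E n)" for n
    unfolding E_def
    by (intro closed_Collect_all closed_Collect_le continuous_intros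
        bounded_linear.continuous_on[OF bounded_linear_ip_left])
  have "u \<in> \<Union>(range E)" for u
  proof -
    obtain n :: real where n: "\<And>i. norm (ip u (g i)) \<le> n * c i" using assms(1) by blast
    obtain N :: nat where "n \<le> real N" using real_arch_simple by blast
    then have "norm (ip u (g i)) \<le> real N * c i" for i
      using n[of i] c[of i] by (meson mult_right_mono order_trans)
    then show ?thesis by (auto simp: E_def)
  qed
  then have "\<Union>(range E) = UNIV" by blast
  moreover have "euclidean interior_of \<Union>(range E) = {}" if "\<And>n. interior (E n) = {}"
    by (rule Baire_category_alt) (use cl that completely_metrizable_space_euclidean in \<open>auto simp flip: closed_closedin\<close>)
  ultimately have "\<exists>n. interior (E n) \<noteq> {}" by auto
  then obtain n u0 where "u0 \<in> interior (E n)" by blast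
  then obtain r where r: "r > 0" "ball u0 r \<subseteq> E n" by (metis mem_interior)
  \<comment> \<open>Vectors of norm less than r are differences of two elements of the ball contained in E n.\<close>
  have small: "norm (ip w (g i)) \<le> 2 * real n * c i" if "norm w < r" for w i
  proof -
    have "u0 + w \<in> E n" "u0 \<in> E n" using r that by (auto simp: subset_iff dist_norm)
    then have "norm (ip (u0 + w) (g i)) \<le> real n * c i" "norm (ip u0 (g i)) \<le> real n * c i"
      by (auto simp: E_def)
    moreover have "ip w (g i) = ip (u0 + w) (g i) - ip u0 (g i)" by (simp add: ip_add_left)
    ultimately show ?thesis using norm_triangle_ineq4[of "ip (u0 + w) (g i)" "ip u0 (g i)"] by simp
  qed
  show thesis
  proof
    show "4 * real n / r \<ge> 0" using r by simp
    fix u i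
    show "norm (ip u (g i)) \<le> 4 * real n / r * norm u * c i"
    proof (cases "u = 0")
      case True
      then show ?thesis using linear_0[OF bounded_linear.linear[OF bounded_linear_ip_left]] by simp
    next
      case False
      have "norm (ip ((r / (2 * norm u)) *\<^sub>R u) (g i)) \<le> 2 * real n * c i"
        by (rule small) (use False r in simp)
      then show ?thesis using False r by (simp add: ip_scaleR_left field_simps)
    qed
  qed
qed

text \<open>For fixed \<open>u\<close>, \<open>ip u (T' y) = ip (T u) y\<close> is bounded by a multiple of \<open>norm y\<close>. The bound can be
  chosen proportional to \<open>norm u\<close> by uniform boundedness, and \<open>y = T u\<close> gives the claim.\<close>
lemma adjointable_bounded:
  assumes T: "\<And>x y. ip (T x) y = ip x (T' y)"
  obtains t where "t \<ge> 0" "\<And>x. norm (T x) \<le> t * norm x"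
proof -
  have "\<exists>n::real. \<forall>y. norm (ip u (T' y)) \<le> n * norm y" for u
    using norm_ip_le[of "T u"] by (auto simp: T[symmetric])
  then obtain m where m: "m \<ge> 0" "\<And>u y. norm (ip u (T' y)) \<le> m * norm u * norm y"
    using ip_uniform_boundedness[of T' norm] by (metis norm_ge_zero)
  have "norm (T x) \<le> m * norm x" for x
  proof (cases "T x = 0")
    case False
    have "norm (T x) * norm (T x) \<le> m * norm x * norm (T x)"
      using m(2)[of x "T x"] by (simp add: norm_ip_self power2_eq_square flip: T)
    then show ?thesis using False by simp
  qed (use m in simp)
  then show thesis using that m(1) by blast
qed

text \<open>For fixed \<open>u = K v\<close>, \<open>ip u y = ip v (K' y)\<close> is bounded by a multiple of \<open>norm (K' y)\<close>. The bound can be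
  chosen proportional to \<open>norm u\<close> by uniform boundedness, and \<open>u = y\<close> gives the claim.\<close>
lemma adjoint_of_surjective_bounded_below:
  assumes K: "\<And>x y. ip (K x) y = ip x (K' y)" and "surj K"
  obtains C where "C \<ge> 0" "\<And>x. norm x \<le> C * norm (K' x)"
proof -
  have "\<exists>n::real. \<forall>y. norm (ip u y) \<le> n * norm (K' y)" for u
  proof -
    obtain v where "u = K v" using \<open>surj K\<close> by blast
    then show ?thesis using norm_ip_le[of v] by (auto simp: K)
  qed
  then obtain m where m: "m \<ge> 0" "\<And>u y. norm (ip u y) \<le> m * norm u * norm (K' y)"
    using ip_uniform_boundedness[of "\<lambda>y. y" "\<lambda>y. norm (K' y)"] by (metis norm_ge_zero)
  have "norm x \<le> m * norm (K' x)" for x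
  proof (cases "x = 0")
    case False
    have "norm x * norm x \<le> (m * norm (K' x)) * norm x"
      using m(2)[of x x] by (simp add: norm_ip_self power2_eq_square mult_ac)
    then show ?thesis using False by simp
  qed (use m in simp)
  then show thesis using that m(1) by blast
qed

lemma adjointable_additive:
  assumes T: "\<And>x y. ip (T x) y = ip x (T' y)" shows "T (x + y) = T x + T y"
  by (rule ip_eqI_left) (simp add: T ip_add_left)

lemma adjointable_act:
  assumes T: "\<And>x y. ip (T x) y = ip x (T' y)" shows "T (act a x) = act a (T x)"
  by (rule ip_eqI_left) (simp add: T ip_act_left)

lemma adjointable_bounded_linear:
  assumes T: "\<And>x y. ip (T x) y = ip x (T' y)" shows "bounded_linear T"
proof -
  obtain t where "\<And>x. norm (T x) \<le> t * norm x" using adjointable_bounded[OF T] by metis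
  then show ?thesis
    by (intro bounded_linear_intro[where K=t] adjointable_additive[OF T])
       (auto simp: mult.commute T ip_scaleR_left intro: ip_eqI_left)
qed

lemma ip_adjoint_op:
  assumes "T \<in> End_star ip ip UNIV"
  shows "ip (T x) y = ip x (adjoint_op ip ip T y)" "ip (adjoint_op ip ip T x) y = ip x (T y)"
proof -
  show *: "ip (T x) y = ip x (adjoint_op ip ip T y)" for x y
    using adjoint_op_eq[OF hilbert_module_axioms assms] by simp
  show "ip (adjoint_op ip ip T x) y = ip x (T y)"
    by (subst (1 2) ip_commute) (simp add: *)
qed

end

section \<open>Bounded operators and the Bochner integral\<close>

text \<open>The integrand \<open>g\<close> is compared with \<open>T \<circ> f\<close> on the space of \<open>M\<close> only: off that space the
  operators of a frame are arbitrary functions and their adjoints unspecified.\<close>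
lemma has_strong_bochner_integral_bounded_linear:
  assumes T: "bounded_linear T" and f: "has_strong_bochner_integral M f I"
    and g: "\<And>w. w \<in> space M \<Longrightarrow> g w = T (f w)"
  shows "has_strong_bochner_integral M g (T I)"
proof -
  interpret T: bounded_linear T by fact
  obtain s where s: "\<And>i. Bochner_Integration.simple_bochner_integrable M (s i)"
      "(\<lambda>i. \<integral>\<^sup>+w. ennreal (norm (f w - s i w)) \<partial>M) \<longlonglongrightarrow> 0"
      "(\<lambda>i. Bochner_Integration.simple_bochner_integral M (s i)) \<longlonglongrightarrow> I"
    using f by (auto simp: has_strong_bochner_integral_def)
  have sm: "strongly_measurable M f" using f by (simp add: has_strong_bochner_integral_def)
  have sf: "simple_function M (s i)" for i using s(1) by (auto elim: simple_bochner_integrable.cases)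
  obtain K where K: "K > 0" "\<And>x. norm (T x) \<le> norm x * K" using T.pos_bounded by blast
  show ?thesis
    unfolding has_strong_bochner_integral_def
  proof (intro conjI exI[of _ "\<lambda>i w. T (s i w)"] allI)
    obtain u where u: "\<And>i. simple_function M (u i)" "\<And>w. w \<in> space M \<Longrightarrow> (\<lambda>i. u i w) \<longlonglongrightarrow> f w"
      using sm by (auto simp: strongly_measurable_def)
    show "strongly_measurable M g"
      unfolding strongly_measurable_def
    proof (intro exI[of _ "\<lambda>i w. T (u i w)"] conjI allI ballI)
      show "simple_function M (\<lambda>w. T (u i w))" for i by (rule simple_function_compose1[OF u(1)])
      show "(\<lambda>i. T (u i w)) \<longlonglongrightarrow> g w" if "w \<in> space M" for w
        using T.tendsto[OF u(2)[OF that]] g[OF that] by simp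
    qed
    show "Bochner_Integration.simple_bochner_integrable M (\<lambda>w. T (s i w))" for i
      by (rule simple_bochner_integrable_compose2[where p="\<lambda>x y. T x", OF T.zero s(1) s(1)])
    show "(\<lambda>i. Bochner_Integration.simple_bochner_integral M (\<lambda>w. T (s i w))) \<longlonglongrightarrow> T I"
      using T.tendsto[OF s(3)] by (simp add: simple_bochner_integral_linear[OF T.linear_axioms s(1)])
    have le: "(\<integral>\<^sup>+w. ennreal (norm (g w - T (s i w))) \<partial>M)
        \<le> ennreal K * (\<integral>\<^sup>+w. ennreal (norm (f w - s i w)) \<partial>M)" for i
    proof -
      have "(\<integral>\<^sup>+w. ennreal (norm (g w - T (s i w))) \<partial>M)
          \<le> (\<integral>\<^sup>+w. ennreal K * ennreal (norm (f w - s i w)) \<partial>M)"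
      proof (rule nn_integral_mono)
        fix w assume w: "w \<in> space M"
        have "norm (g w - T (s i w)) \<le> K * norm (f w - s i w)"
          using K(2)[of "f w - s i w"] by (simp add: g[OF w] T.diff mult.commute)
        then show "ennreal (norm (g w - T (s i w))) \<le> ennreal K * ennreal (norm (f w - s i w))"
          using K(1) by (simp add: ennreal_leI flip: ennreal_mult)
      qed
      also have "\<dots> = ennreal K * (\<integral>\<^sup>+w. ennreal (norm (f w - s i w)) \<partial>M)"
        by (intro nn_integral_cmult measurable_compose[OF strongly_measurable_norm_diff[OF sm sf] measurable_ennreal])
      finally show ?thesis .
    qed
    show "(\<lambda>i. \<integral>\<^sup>+w. ennreal (norm (g w - T (s i w))) \<partial>M) \<longlonglongrightarrow> 0"
    proof (rule tendsto_sandwich[OF _ _ tendsto_const])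
      show "\<forall>\<^sub>F i in sequentially. (\<integral>\<^sup>+w. ennreal (norm (g w - T (s i w))) \<partial>M)
          \<le> ennreal K * (\<integral>\<^sup>+w. ennreal (norm (f w - s i w)) \<partial>M)" using le by simp
      show "(\<lambda>i. ennreal K * (\<integral>\<^sup>+w. ennreal (norm (f w - s i w)) \<partial>M)) \<longlonglongrightarrow> 0"
        using ennreal_tendsto_cmult[OF _ s(2)] by simp
    qed simp
  qed
qed

section \<open>Perturbed frames\<close>

lemma adjoint_op_compose:
  assumes U: "hilbert_module actU ipU" and L: "L \<in> End_star ipU ipV W"
    and T: "T \<in> End_star ipU ipU UNIV" and y: "y \<in> W"
  shows "adjoint_op ipU ipV (L \<circ> T) y = adjoint_op ipU ipU T (adjoint_op ipU ipV L y)"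
proof -
  interpret U: hilbert_module actU ipU by fact
  have eq: "ipV ((L \<circ> T) x) y = ipU x (adjoint_op ipU ipU T (adjoint_op ipU ipV L y))" for x
    using adjoint_op_eq[OF U L y] U.ip_adjoint_op(1)[OF T] by simp
  show ?thesis
    unfolding adjoint_op_def[of ipU ipV "L \<circ> T"] eq
    by (rule the_equality) (auto intro: U.ip_eqI)
qed

lemma End_star_compose:
  assumes "L \<in> End_star ipU ipV W" "T \<in> End_star ipU ipU UNIV"
  shows "L \<circ> T \<in> End_star ipU ipV W"
proof -
  obtain L' T' where "\<forall>x. L x \<in> W" "\<forall>x. \<forall>y\<in>W. ipV (L x) y = ipU x (L' y)" "\<forall>x y. ipU (T x) y = ipU x (T' y)"
    using assms by (auto simp: End_star_def)
  then show ?thesis unfolding End_star_def by (auto intro!: exI[of _ "T' \<circ> L'"])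
qed

lemma strictly_nonzero_scaleR: "strictly_nonzero a \<Longrightarrow> r \<noteq> 0 \<Longrightarrow> strictly_nonzero (r *\<^sub>R a)"
  by (simp add: strictly_nonzero_iff_invertible invertible_elem_scaleR)

theorem theorem2p5:
  fixes actU :: "'a::unital_cstar_algebra \<Rightarrow> 'u::complex_banach \<Rightarrow> 'u"
    and ipU :: "'u \<Rightarrow> 'u \<Rightarrow> 'a"
    and actV :: "'a \<Rightarrow> 'v::complex_banach \<Rightarrow> 'v"
    and ipV :: "'v \<Rightarrow> 'v \<Rightarrow> 'a"
    and M :: "'w measure"
    and Vw :: "'w \<Rightarrow> 'v set"
    and K T S :: "'u \<Rightarrow> 'u"
    and \<Lambda> :: "'w \<Rightarrow> 'u \<Rightarrow> 'v"
    and A B :: 'a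
  assumes "hilbert_module actU ipU"
    and "hilbert_module actV ipV"
    and "\<And>w. w \<in> space M \<Longrightarrow> closed_submodule actV (Vw w)"
    and "K \<in> End_star ipU ipU UNIV"
    and "surj K"
    and "continuous_star_K_g_frame_bounds M ipU ipV Vw K \<Lambda> A B"
    and "frame_operator_exists M ipU ipV \<Lambda>"
    and "S = frame_operator M ipU ipV \<Lambda>"
    and "T \<in> End_star ipU ipU UNIV"
    and "invertible_in_End_star ipU T"
  shows "continuous_star_K_g_frame M ipU ipV Vw K (\<lambda>w. \<Lambda> w \<circ> T)
    \<and> frame_operator_exists M ipU ipV (\<lambda>w. \<Lambda> w \<circ> T)
    \<and> frame_operator M ipU ipV (\<lambda>w. \<Lambda> w \<circ> T) = adjoint_op ipU ipU T \<circ> S \<circ> T"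
proof -
  interpret U: hilbert_module actU ipU by fact
  let ?K' = "adjoint_op ipU ipU K" and ?T' = "adjoint_op ipU ipU T"
  let ?J = "\<lambda>x. strong_bochner_integral M (\<lambda>w. ipV (\<Lambda> w x) (\<Lambda> w x))"
  note K = U.ip_adjoint_op[OF assms(4)]
  note T = U.ip_adjoint_op[OF assms(9)]
  note frame = assms(6)[unfolded continuous_star_K_g_frame_bounds_def]
  have \<Lambda>: "\<Lambda> w \<in> End_star ipU ipV (Vw w)" if "w \<in> space M" for w using frame that by blast

  obtain R where R: "R \<in> End_star ipU ipU UNIV" "\<And>x. R (T x) = x"
    using assms(10) unfolding invertible_in_End_star_def by (metis comp_apply id_apply)
  obtain t where t: "t \<ge> 0" "\<And>x. norm (T x) \<le> t * norm x" using U.adjointable_bounded[OF T(1)] by blast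
  obtain r where r: "r \<ge> 0" "\<And>x. norm (R x) \<le> r * norm x"
    using U.adjointable_bounded[OF U.ip_adjoint_op(1)[OF R(1)]] by blast
  obtain k where k: "k \<ge> 0" "\<And>x. norm (?K' x) \<le> k * norm x" using U.adjointable_bounded[OF K(2)] by blast
  obtain C where C: "C \<ge> 0" "\<And>x. norm x \<le> C * norm (?K' x)"
    using U.adjoint_of_surjective_bounded_below[OF K(1) assms(5)] by blast

  \<comment> \<open>The norm estimates behind the lower bound: K' is bounded, T is bounded below because it has the
    bounded left inverse R, and K' is bounded below because K is surjective.\<close>
  have "norm (?K' x) \<le> (k * r * C) * norm (?K' (T x))" for x
  proof -
    have "norm (?K' x) \<le> k * norm x" by (rule k)
    also have "norm x \<le> r * norm (T x)" using r(2)[of "T x"] by (simp add: R)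
    also have "norm (T x) \<le> C * norm (?K' (T x))" by (rule C)
    finally show ?thesis using k r by (simp add: mult_left_mono mult.assoc)
  qed
  then obtain \<epsilon> where \<epsilon>: "\<epsilon> > 0"
      "\<And>x. positive_elem (ipU (?K' (T x)) (?K' (T x)) - \<epsilon>\<^sup>2 *\<^sub>R ipU (?K' x) (?K' x))"
    using k(1) r(1) C(1)
    by (rule_tac U.ip_self_dominated[of ?K' "\<lambda>x. ?K' (T x)" "k * r * C"])
       (simp_all add: U.adjointable_act[OF K(2)] U.adjointable_act[OF T(1)])
  obtain \<delta> where \<delta>: "\<delta> > 0" "\<And>x. positive_elem (ipU x x - \<delta>\<^sup>2 *\<^sub>R ipU (T x) (T x))"
    using t by (rule_tac U.ip_self_dominated[of T "\<lambda>x. x" t]) (simp_all add: U.adjointable_act[OF T(1)])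

  \<comment> \<open>The element A is brought inside the inner products by evaluating the domination at A x.\<close>
  have lower: "(\<epsilon> *\<^sub>R A) * ipU (?K' x) (?K' x) * star (\<epsilon> *\<^sub>R A) \<preceq> ?J (T x)" for x
  proof (rule cstar_le_trans)
    let ?z = "actU A x"
    have "positive_elem (ipU (?K' (T ?z)) (?K' (T ?z)) - \<epsilon>\<^sup>2 *\<^sub>R ipU (?K' ?z) (?K' ?z))" by (rule \<epsilon>)
    then have "positive_elem (A * ipU (?K' (T x)) (?K' (T x)) * star A
        - (\<epsilon> *\<^sub>R A) * ipU (?K' x) (?K' x) * star (\<epsilon> *\<^sub>R A))"
      by (simp add: U.adjointable_act[OF K(2)] U.adjointable_act[OF T(1)] U.ip_act_act star_scaleR power2_eq_square)
    then show "(\<epsilon> *\<^sub>R A) * ipU (?K' x) (?K' x) * star (\<epsilon> *\<^sub>R A) \<preceq> A * ipU (?K' (T x)) (?K' (T x)) * star A"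
      by (simp only: cstar_le_def U.selfadjoint_conjugate_ip simp_thms)
    show "A * ipU (?K' (T x)) (?K' (T x)) * star A \<preceq> ?J (T x)" using frame by blast
  qed
  have upper: "?J (T x) \<preceq> ((1 / \<delta>) *\<^sub>R B) * ipU x x * star ((1 / \<delta>) *\<^sub>R B)" for x
  proof (rule cstar_le_trans)
    let ?z = "actU B x"
    have "positive_elem ((1 / \<delta>\<^sup>2) *\<^sub>R (ipU ?z ?z - \<delta>\<^sup>2 *\<^sub>R ipU (T ?z) (T ?z)))"
      by (intro positive_elem_scaleR \<delta>) (use \<delta> in simp)
    then have "positive_elem (((1 / \<delta>) *\<^sub>R B) * ipU x x * star ((1 / \<delta>) *\<^sub>R B) - B * ipU (T x) (T x) * star B)"
      using \<delta>(1) by (simp add: U.adjointable_act[OF T(1)] U.ip_act_act star_scaleR power2_eq_square scaleR_diff_right)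
    then show "B * ipU (T x) (T x) * star B \<preceq> ((1 / \<delta>) *\<^sub>R B) * ipU x x * star ((1 / \<delta>) *\<^sub>R B)"
      by (simp only: cstar_le_def U.selfadjoint_conjugate_ip simp_thms)
    show "?J (T x) \<preceq> B * ipU (T x) (T x) * star B" using frame by blast
  qed
  have "continuous_star_K_g_frame_bounds M ipU ipV Vw K (\<lambda>w. \<Lambda> w \<circ> T) (\<epsilon> *\<^sub>R A) ((1 / \<delta>) *\<^sub>R B)"
    unfolding continuous_star_K_g_frame_bounds_def
    using frame \<epsilon>(1) \<delta>(1) lower upper
    by (auto intro!: End_star_compose[OF \<Lambda> assms(9)] strictly_nonzero_scaleR)

  moreover have int: "has_strong_bochner_integral M (\<lambda>w. adjoint_op ipU ipV (\<Lambda> w \<circ> T) ((\<Lambda> w \<circ> T) x)) (?T' (S (T x)))" for x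
  proof (rule has_strong_bochner_integral_bounded_linear[OF U.adjointable_bounded_linear[OF T(2)]])
    have "strong_bochner_integrable M (\<lambda>w. adjoint_op ipU ipV (\<Lambda> w) (\<Lambda> w (T x)))"
      using assms(7) by (simp add: frame_operator_exists_def)
    then show "has_strong_bochner_integral M (\<lambda>w. adjoint_op ipU ipV (\<Lambda> w) (\<Lambda> w (T x))) (S (T x))"
      unfolding assms(8) frame_operator_def strong_bochner_integrable_def
      using has_strong_bochner_integral_eq by metis
    fix w assume w: "w \<in> space M"
    have "\<Lambda> w (T x) \<in> Vw w" using \<Lambda>[OF w] by (simp add: End_star_def)
    then show "adjoint_op ipU ipV (\<Lambda> w \<circ> T) ((\<Lambda> w \<circ> T) x) = ?T' (adjoint_op ipU ipV (\<Lambda> w) (\<Lambda> w (T x)))"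
      using adjoint_op_compose[OF assms(1) \<Lambda>[OF w] assms(9)] by simp
  qed
  ultimately show ?thesis
    unfolding continuous_star_K_g_frame_def frame_operator_exists_def strong_bochner_integrable_def
    by (auto simp: fun_eq_iff frame_operator_def has_strong_bochner_integral_eq)
qed

end
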